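(* Let $G$ be a $2k$-regular graph with $n\ge 3$ vertices such that $p=k+1\ge 3$ is prime. Then, for every admissible choice of the vertices $0,\infty$ and of the edge orientations, $$\mathsf M(G)\equiv (-1)^{n-1}\operatorname{Perm}(G)^2 \pmod p.$$
   Context: Graphs are finite and undirected, and may have multiple edges and self-loops. A graph is $2k$-regular if every vertex has degree $2k$ (a self-loop counts $2$). Graph permanent. Choose two distinct vertices of $G$, called $0$ and $\infty$, such that $\infty$ has no self-loop, and orient every edge. Then $G\setminus\infty$ has $k(n-2)$ edges. Let $A$ be the $(n-2)\times k(n-2)$ matrix: - its rows are indexed by the vertices other than $0,\infty$; - its columns are indexed by the edges not incident to $\infty$; - $A_{ve}=+1$ if $e$ points to $v$, $A_{ve}=-1$ if $e$ comes from $v$, and $A_{ve}=0$ otherwise. Let $A^{[k]}$ be the $k(n-2)\times k(n-2)$ matrix obtained by stacking $k$ copies of $A$ vertically. Define $\operatorname{Perm}(G)=\operatorname{perm}A^{[k]}$. This number depends on the choices made. Transitions. Let $v$ be a vertex without self-loops, with edges $e_i=vw_i$. A transition at $v$ is a partition $\tau$ of these $2k$ edges into pairs; $\mathcal T(v)$ is the set of transitions at $v$. The graph $G_\tau$ deletes $v$ and its incident edges and adds an edge $w_iw_j$ for each pair $\{e_i,e_j\}\in\tau$. Martin invariant. For $2k$-regular graphs with at least 3 vertices: - $\mathsf M(G)=0$ if $G$ has a self-loop; - $\mathsf M(G)=1$ if $G$ has 3 vertices and no self-loop; - otherwise $\mathsf M(G)=\sum_{\tau\in\mathcal T(v)}\mathsf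 M(G_\tau)$ for any vertex $v$; this is independent of $v$. *)

theory Defs
  imports "HOL-Library.Uprod" "HOL-Library.Disjoint_Sets" "HOL-Library.FuncSet"
    "HOL-Number_Theory.Cong" "HOL-Computational_Algebra.Primes"
begin

record ('v, 'e) mgraph =
  verts :: "'v set"
  edges :: "'e set"
  ends :: "'e \<Rightarrow> 'v uprod"

definition multigraph :: "('v, 'e) mgraph \<Rightarrow> bool" where
  "multigraph G \<longleftrightarrow> finite (verts G) \<and> finite (edges G) \<and>
     (\<forall>e \<in> edges G. set_uprod (ends G e) \<subseteq> verts G)"

definition edges_at :: "('v, 'e) mgraph \<Rightarrow> 'v \<Rightarrow> 'e set" where
  "edges_at G v = {e \<in> edges G. v \<in> set_uprod (ends G e)}"

definition loops_at :: "('v, 'e) mgraph \<Rightarrow> 'v \<Rightarrow> 'e set" where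
  "loops_at G v = {e \<in> edges G. ends G e = Upair v v}"

definition has_loop :: "('v, 'e) mgraph \<Rightarrow> bool" where
  "has_loop G \<longleftrightarrow> (\<exists>v \<in> verts G. loops_at G v \<noteq> {})"

definition degree :: "('v, 'e) mgraph \<Rightarrow> 'v \<Rightarrow> nat" where
  "degree G v = card (edges_at G v) + card (loops_at G v)"

definition regular :: "nat \<Rightarrow> ('v, 'e) mgraph \<Rightarrow> bool" where
  "regular d G \<longleftrightarrow> (\<forall>v \<in> verts G. degree G v = d)"


section \<open>Graph permanent\<close>

definition orientation :: "('v, 'e) mgraph \<Rightarrow> ('e \<Rightarrow> 'v) \<Rightarrow> ('e \<Rightarrow> 'v) \<Rightarrow> bool" where
  "orientation G src tgt \<longleftrightarrow> (\<forall>e \<in> edges G. ends G e = Upair (src e) (tgt e))"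

text \<open>The entry of a self-loop at \<open>v\<close> in row \<open>v\<close> is \<open>1 - 1 = 0\<close>.\<close>

definition incidence :: "('e \<Rightarrow> 'v) \<Rightarrow> ('e \<Rightarrow> 'v) \<Rightarrow> 'v \<Rightarrow> 'e \<Rightarrow> int" where
  "incidence src tgt v e = of_bool (tgt e = v) - of_bool (src e = v)"

text \<open>The permanent is invariant under permutations of rows and of columns, so it makes sense for
  a matrix whose rows and columns are indexed by two finite sets of equal size. The functions
  are taken extensional so that each bijection is counted exactly once.\<close>

definition permanent :: "'r set \<Rightarrow> 'c set \<Rightarrow> ('r \<Rightarrow> 'c \<Rightarrow> int) \<Rightarrow> int" where
  "permanent R C A = (\<Sum>f | f \<in> R \<rightarrow>\<^sub>E C \<and> bij_betw f R C. \<Prod>r\<in>R. A r (f r))"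

text \<open>Row \<open>(v, i)\<close> is row \<open>v\<close> of the \<open>i\<close>-th of the \<open>k\<close> stacked copies; \<open>z\<close> and \<open>u\<close> are the
  vertices called \<open>0\<close> and \<open>\<infinity>\<close>.\<close>

definition graph_perm ::
  "nat \<Rightarrow> ('v, 'e) mgraph \<Rightarrow> 'v \<Rightarrow> 'v \<Rightarrow> ('e \<Rightarrow> 'v) \<Rightarrow> ('e \<Rightarrow> 'v) \<Rightarrow> int" where
  "graph_perm k G z u src tgt =
     permanent ((verts G - {z, u}) \<times> {..<k}) (edges G - edges_at G u)
       (\<lambda>(v, i) e. incidence src tgt v e)"


section \<open>Martin invariant\<close>

definition transitions :: "('v, 'e) mgraph \<Rightarrow> 'v \<Rightarrow> 'e set set set" where
  "transitions G v = {\<tau>. partition_on (edges_at G v) \<tau> \<and> (\<forall>P \<in> \<tau>. card P = 2)}"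

definition other_end :: "('v, 'e) mgraph \<Rightarrow> 'v \<Rightarrow> 'e \<Rightarrow> 'v" where
  "other_end G v e = (THE w. ends G e = Upair v w)"

definition partner :: "'e set set \<Rightarrow> 'e \<Rightarrow> 'e" where
  "partner \<tau> e = (THE e'. e' \<noteq> e \<and> {e, e'} \<in> \<tau>)"

text \<open>The graph \<open>G\<^sub>\<tau>\<close>. To stay within the same type of edge names, the new edge created by a pair
  of \<open>\<tau>\<close> reuses the name of one (arbitrary) edge of that pair; the pairs are disjoint, so
  different pairs create different edges.\<close>

definition resolve :: "('v, 'e) mgraph \<Rightarrow> 'v \<Rightarrow> 'e set set \<Rightarrow> ('v, 'e) mgraph" where
  "resolve G v \<tau> =
     \<lparr> verts = verts G - {v},
       edges = (edges G - edges_at G v) \<union> (\<lambda>P. SOME e. e \<in> P) ` \<tau>,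
       ends = (\<lambda>e. if e \<in> edges_at G v
                   then Upair (other_end G v e) (other_end G v (partner \<tau> e))
                   else ends G e) \<rparr>"

text \<open>The parameter \<open>c\<close> selects the vertex at which each graph is expanded. The invariant does not
  depend on it, provided that \<open>c H\<close> always is a vertex of \<open>H\<close> (predicate \<open>selector\<close>); nothing
  below relies on this independence. The value \<open>0\<close> for graphs with fewer than three vertices
  and for \<open>c G \<notin> verts G\<close> is irrelevant and only makes the function total.\<close>

definition selector :: "(('v, 'e) mgraph \<Rightarrow> 'v) \<Rightarrow> bool" where
  "selector c \<longleftrightarrow> (\<forall>H. verts H \<noteq> {} \<longrightarrow> c H \<in> verts H)"

function martin :: "(('v, 'e) mgraph \<Rightarrow> 'v) \<Rightarrow> ('v, 'e) mgraph \<Rightarrow> nat" where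
  "martin c G =
     (if card (verts G) < 3 then 0
      else if has_loop G then 0
      else if card (verts G) = 3 then 1
      else if c G \<notin> verts G then 0
      else (\<Sum>\<tau> \<in> transitions G (c G). martin c (resolve G (c G) \<tau>)))"
  by pat_completeness auto

termination
proof (relation "measure (\<lambda>(c, G). card (verts G))", goal_cases)
  case (2 c G \<tau>)
  then have "finite (verts G)" by (metis card.infinite zero_less_numeral)
  with 2 have "card (verts G - {c G}) < card (verts G)" by (meson card_Diff1_less)
  then show ?case by (simp add: resolve_def)
qed simp

declare martin.simps [simp del]

end

theory Submission
  imports "HOL-Library.Poly_Mapping" "HOL-Library.Function_Algebras" "HOL-Number_Theory.Residues" Defs
begin

text \<open>
  Let \<open>\<Phi>\<close> be the product over all edges of \<open>X\<^sub>t - X\<^sub>s\<close>, with one variable per vertex, \<open>t\<close> the target and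
  \<open>s\<close> the source, and let \<open>N(z, u)\<close> be its coefficient at the monomial with exponent \<open>2k\<close> at \<open>u\<close>,
  \<open>0\<close> at \<open>z\<close> and \<open>k\<close> elsewhere. The permanent is \<open>\<plusminus> (k!)\<^bsup>n-2\<^esup> N(z, u)\<close>, so by Wilson's theorem its square
  is \<open>N(z, u)\<^sup>2\<close> modulo \<open>p\<close>.

  Modulo \<open>p\<close>, the square does not depend on \<open>z\<close> and \<open>u\<close>: exchanging the two ends of every edge
  exchanges \<open>z\<close> and \<open>u\<close>, and since \<open>\<Phi>\<close> is invariant under translation of all variables while
  differentiation turns an exponent \<open>k + 1 = p\<close> into a factor \<open>0\<close>, exponents can be shifted from one
  vertex to another without changing the coefficient.

  Now let \<open>v\<close> be another vertex, without self-loops, and let \<open>r S\<close>, for a \<open>k\<close>-subset \<open>S\<close> of the \<open>2k\<close>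
  edges at \<open>v\<close>, be the contribution to \<open>N\<close> of the terms choosing at the edges of \<open>S\<close> the end other than
  \<open>v\<close>. Then \<open>N = \<plusminus> \<Sum>\<^sub>S r S\<close>, while for a transition \<open>\<tau>\<close> the coefficient of \<open>G\<^sub>\<tau>\<close> is the signed sum of
  \<open>r S\<close> over the transversals \<open>S\<close> of \<open>\<tau>\<close>. In the sum of the squares over all \<open>\<tau>\<close>, the product
  \<open>r S * r T\<close> occurs with the factor \<open>(-1)\<^bsup>k-a\<^esup> a! (k-a)!\<close>, \<open>a\<close> being the size of \<open>S \<inter> T\<close>, which is
  \<open>-1\<close> modulo \<open>p\<close>. Hence \<open>(-1)\<^bsup>n-1\<^esup> N\<^sup>2\<close> satisfies the recursion of the Martin invariant.
\<close>

section \<open>Polynomials with exponents in a function space\<close>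

text \<open>Exponents are total functions with pointwise addition, so a coefficient can be read at
  an explicitly updated exponent such as \<open>d(v := 0)\<close>.\<close>

type_synonym 'v mpol = "('v \<Rightarrow> nat) \<Rightarrow>\<^sub>0 int"

abbreviation lookup :: "'v mpol \<Rightarrow> ('v \<Rightarrow> nat) \<Rightarrow> int" where
  "lookup \<equiv> Poly_Mapping.lookup"

definition unit_exp :: "'v \<Rightarrow> 'v \<Rightarrow> nat" where
  "unit_exp x = (\<lambda>y. of_bool (y = x))"

definition Var :: "'v \<Rightarrow> 'v mpol" where
  "Var x = Poly_Mapping.single (unit_exp x) 1"

lemma lookup_single_times_plus [simp]:
  fixes f :: "'v mpol"
  shows "lookup (Poly_Mapping.single m c * f) (m + d) = c * lookup f d"
proof -
  have "lookup (Poly_Mapping.single m c * f) (m + d)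
      = (\<Sum>l. (c when m = l) * (\<Sum>q. lookup f q when m + d = l + q))"
    by (simp add: lookup_mult lookup_single)
  also have "\<dots> = (\<Sum>l. c * (\<Sum>q. lookup f q when m + d = l + q) when m = l)"
    by (simp add: when_mult)
  also have "\<dots> = c * (\<Sum>q. lookup f q when d = q)"
    by simp
  finally show ?thesis by simp
qed

lemma lookup_single_times_eq_0:
  fixes f :: "'v mpol"
  assumes "\<not> m \<le> d"
  shows "lookup (Poly_Mapping.single m c * f) d = 0"
proof -
  have "d \<noteq> m + q" for q
    using assms by (auto simp: le_fun_def)
  have "lookup (Poly_Mapping.single m c * f) d
      = (\<Sum>l. c * (\<Sum>q. lookup f q when d = l + q) when m = l)"
    by (simp add: lookup_mult lookup_single when_mult)
  then show ?thesis using \<open>\<And>q. d \<noteq> m + q\<close> by simp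
qed

lemma lookup_single_times:
  fixes f :: "'v mpol"
  shows "lookup (Poly_Mapping.single m c * f) d = (if m \<le> d then c * lookup f (d - m) else 0)"
proof (cases "m \<le> d")
  case True
  then have "d = m + (d - m)" by (auto simp: le_fun_def)
  then show ?thesis using True lookup_single_times_plus[of m c f "d - m"] by simp
qed (simp add: lookup_single_times_eq_0)

lemma single_prod:
  "(\<Prod>x\<in>A. Poly_Mapping.single (m x) (c x)) = Poly_Mapping.single (\<Sum>x\<in>A. m x) (\<Prod>x\<in>A. c x)"
  for m :: "'a \<Rightarrow> 'v \<Rightarrow> nat" and c :: "'a \<Rightarrow> int"
  by (induction A rule: infinite_finite_induct)
    (simp_all only: prod.infinite sum.infinite prod.empty sum.empty prod.insert sum.insert
      single_one mult_single not_False_eq_True)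

lemma sum_fun_apply: "(\<Sum>e\<in>A. f e) x = (\<Sum>e\<in>A. f e x)" for f :: "'a \<Rightarrow> 'b \<Rightarrow> nat"
  by (induction A rule: infinite_finite_induct) auto

section \<open>Polynomials free of one variable\<close>

definition var_free :: "'v \<Rightarrow> 'v mpol \<Rightarrow> bool" where
  "var_free v f \<longleftrightarrow> (\<forall>m. lookup f m \<noteq> 0 \<longrightarrow> m v = 0)"

lemma var_free_mult: "var_free v f \<Longrightarrow> var_free v g \<Longrightarrow> var_free v (f * g)"
  unfolding var_free_def
proof (intro allI impI)
  fix m
  assume f: "\<forall>m. lookup f m \<noteq> 0 \<longrightarrow> m v = 0" and g: "\<forall>m. lookup g m \<noteq> 0 \<longrightarrow> m v = 0"
    and m: "lookup (f * g) m \<noteq> 0"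
  then obtain a b where "m = a + b" "lookup f a \<noteq> 0" "lookup g b \<noteq> 0"
    using keys_mult[of f g] by (force simp flip: lookup_not_eq_zero_eq_in_keys)
  then show "m v = 0" using f g by simp
qed

lemma var_free_diff: "var_free v f \<Longrightarrow> var_free v g \<Longrightarrow> var_free v (f - g)"
  unfolding var_free_def by (metis diff_0_right lookup_minus)

lemma var_free_1: "var_free v 1"
  unfolding var_free_def by (auto simp: lookup_one when_def)

lemma var_free_prod: "(\<And>e. e \<in> A \<Longrightarrow> var_free v (f e)) \<Longrightarrow> var_free v (prod f A)"
  by (induction A rule: infinite_finite_induct) (auto intro: var_free_1 var_free_mult)

lemma var_free_Var: "w \<noteq> v \<Longrightarrow> var_free v (Var w)"
  by (auto simp: var_free_def Var_def lookup_single when_def unit_exp_def)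

lemma Var_power: "Var v ^ j = Poly_Mapping.single (\<lambda>y. if y = v then j else 0) 1"
proof (induction j)
  case (Suc j)
  then show ?case by (auto simp: Var_def mult_single unit_exp_def intro!: arg_cong2[where f = Poly_Mapping.single])
qed (simp flip: single_one add: zero_fun_def)

lemma lookup_Var_power_times:
  assumes "var_free v f"
  shows "lookup (Var v ^ j * f) d = (if d v = j then lookup f (d(v := 0)) else 0)"
proof (cases "j \<le> d v")
  case True
  then have "lookup (Var v ^ j * f) d = lookup f (d - (\<lambda>y. if y = v then j else 0))"
    unfolding Var_power lookup_single_times by (simp add: le_fun_def)
  also have "\<dots> = (if d v = j then lookup f (d(v := 0)) else 0)"
  proof (cases "d v = j")
    case True
    then show ?thesis by (auto intro!: arg_cong[where f = "lookup f"])
  next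
    case False
    \<comment> \<open>Here \<open>j < d v\<close>, so after the division a positive exponent of
      \<open>v\<close> is left, which no monomial of \<open>f\<close> has.\<close>
    then have "(d - (\<lambda>y. if y = v then j else 0)) v \<noteq> 0" using True by simp
    then show ?thesis using assms False unfolding var_free_def by metis
  qed
  finally show ?thesis .
next
  case False
  then show ?thesis unfolding Var_power lookup_single_times by (auto simp: le_fun_def)
qed

text \<open>In the expanded product, \<open>S\<close> collects the factors that contribute
  \<open>- Var (w e)\<close>; all others contribute \<open>Var v\<close>. Nothing else contains
  \<open>v\<close>, so \<open>d v\<close> is the size of the complement of \<open>S\<close>. The
  size condition is additive to avoid truncated subtraction.\<close>

lemma lookup_times_prod_Var_diff:
  fixes F :: "'v mpol"
  assumes "finite B" "var_free v F" "\<And>e. e \<in> B \<Longrightarrow> w e \<noteq> v"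
  shows "lookup (F * (\<Prod>e\<in>B. Var v - Var (w e))) d
    = (\<Sum>S | S \<subseteq> B \<and> card B = card S + d v. (-1) ^ card S * lookup (F * (\<Prod>e\<in>S. Var (w e))) (d(v := 0)))"
proof -
  have *: "F * (\<Prod>e\<in>B. Var v - Var (w e))
      = (\<Sum>S\<in>Pow B. (-1) ^ card S * (Var v ^ (card B - card S) * (F * (\<Prod>e\<in>S. Var (w e)))))"
  proof -
    have "(\<Prod>e\<in>B. Var v - Var (w e)) = (\<Prod>e\<in>B. - Var (w e) + Var v)" by simp
    also have "\<dots> = (\<Sum>S\<in>Pow B. (\<Prod>e\<in>S. - Var (w e)) * Var v ^ card (B - S))"
      using assms(1) by (subst prod_add) auto
    also have "\<dots> = (\<Sum>S\<in>Pow B. (-1) ^ card S * (\<Prod>e\<in>S. Var (w e)) * Var v ^ (card B - card S))"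
      using assms(1) by (intro sum.cong) (auto simp: card_Diff_subset finite_subset prod.distrib
          prod_uminus)
    finally have "(\<Prod>e\<in>B. Var v - Var (w e)) = \<dots>" .
    then show ?thesis by (simp add: sum_distrib_left mult_ac)
  qed
  have sgn: "lookup ((-1) ^ j * f) m = (-1) ^ j * lookup f m" for j m and f :: "'v mpol"
    by (cases "even j") auto
  have vf: "var_free v (F * (\<Prod>e\<in>S. Var (w e)))" if "S \<subseteq> B" for S
    using that assms by (intro var_free_mult var_free_prod var_free_Var) auto
  have "lookup (F * (\<Prod>e\<in>B. Var v - Var (w e))) d
     = (\<Sum>S\<in>Pow B. if card B = card S + d v then (-1) ^ card S * lookup (F * (\<Prod>e\<in>S. Var (w e))) (d(v := 0)) else 0)"
    unfolding * lookup_sum sgn 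
  proof (rule sum.cong[OF refl])
    fix S assume S: "S \<in> Pow B"
    then have "card S \<le> card B" using assms(1) by (simp add: card_mono)
    with S vf[of S] show "(-1) ^ card S * lookup (Var v ^ (card B - card S) * (F * (\<Prod>e\<in>S. Var (w e)))) d
      = (if card B = card S + d v then (-1) ^ card S * lookup (F * (\<Prod>e\<in>S. Var (w e))) (d(v := 0)) else 0)"
      by (auto simp: lookup_Var_power_times)
  qed
  also have "\<dots> = (\<Sum>S | S \<subseteq> B \<and> card B = card S + d v. (-1) ^ card S * lookup (F * (\<Prod>e\<in>S. Var (w e))) (d(v := 0)))"
    using assms(1) by (subst sum.inter_filter[symmetric]) (auto intro!: sum.cong)
  finally show ?thesis .
qed


section \<open>Products of differences of variables\<close>

text \<open>The polynomial \<Phi> of the overview, for a bare set of edges so that edges can be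
  split off.\<close>

definition edge_poly :: "'e set \<Rightarrow> ('e \<Rightarrow> 'v) \<Rightarrow> ('e \<Rightarrow> 'v) \<Rightarrow> 'v mpol" where
  "edge_poly E s t = (\<Prod>e\<in>E. Var (t e) - Var (s e))"

text \<open>The degree vector, a self-loop counting twice, written as the exponent of the product of
  all edge ends.\<close>

definition inc_degree :: "'e set \<Rightarrow> ('e \<Rightarrow> 'v) \<Rightarrow> ('e \<Rightarrow> 'v) \<Rightarrow> 'v \<Rightarrow> nat" where
  "inc_degree E s t = (\<Sum>e\<in>E. unit_exp (t e) + unit_exp (s e))"

text \<open>\<open>S\<close> is the set of edges at which the source is chosen, each contributing a
  sign.\<close>

lemma lookup_edge_poly:
  assumes "finite E"
  shows "lookup (edge_poly E s t) d = (\<Sum>S\<in>Pow E. (-1) ^ card S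
    when d = (\<Sum>e\<in>S. unit_exp (s e)) + (\<Sum>e\<in>E - S. unit_exp (t e)))"
proof -
  have "edge_poly E s t = (\<Prod>e\<in>E. Poly_Mapping.single (unit_exp (s e)) (-1) + Poly_Mapping.single (unit_exp (t e)) 1)"
    unfolding edge_poly_def Var_def by (simp add: single_uminus)
  also have "\<dots> = (\<Sum>S\<in>Pow E. Poly_Mapping.single
      ((\<Sum>e\<in>S. unit_exp (s e)) + (\<Sum>e\<in>E - S. unit_exp (t e))) ((-1) ^ card S))"
    using assms by (subst prod_add) (auto simp: single_prod mult_single)
  finally show ?thesis by (simp add: lookup_sum lookup_single eq_commute)
qed

text \<open>Choosing the other end at every edge replaces \<open>S\<close> by \<open>E - S\<close>.
  The two monomials multiply to the product of all ends, the two signs to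
  \<open>(-1) ^ card E\<close>.\<close>

lemma lookup_edge_poly_complement:
  assumes "finite E" "d + d' = inc_degree E s t"
  shows "lookup (edge_poly E s t) d = (-1) ^ card E * lookup (edge_poly E s t) d'"
proof -
  let ?m = "\<lambda>S. (\<Sum>e\<in>S. unit_exp (s e)) + (\<Sum>e\<in>E - S. unit_exp (t e))"
  have m: "?m S + ?m (E - S) = inc_degree E s t" if "S \<subseteq> E" for S
    using that assms(1) sum.subset_diff[OF that assms(1), of "unit_exp \<circ> s"]
      sum.subset_diff[OF that assms(1), of "unit_exp \<circ> t"]
    by (simp add: inc_degree_def sum.distrib double_diff algebra_simps)
  have eq: "d = ?m S \<longleftrightarrow> d' = ?m (E - S)" if "S \<subseteq> E" for S
    using m[OF that] assms(2) by (metis add_left_cancel add_right_cancel)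
  have "lookup (edge_poly E s t) d = (\<Sum>S\<in>Pow E. (-1) ^ card S when d' = ?m (E - S))"
    unfolding lookup_edge_poly[OF assms(1)] using eq by (intro sum.cong when_cong) auto
  also have "\<dots> = (\<Sum>S\<in>Pow E. (-1) ^ card (E - S) when d' = ?m S)"
    by (rule sum.reindex_bij_witness[of _ "\<lambda>S. E - S" "\<lambda>S. E - S"]) (auto simp: double_diff)
  also have "\<dots> = (\<Sum>S\<in>Pow E. (-1) ^ card E * ((-1) ^ card S when d' = ?m S))"
  proof (intro sum.cong refl)
    fix S assume "S \<in> Pow E"
    then have "card E = card (E - S) + card S"
      using assms(1) by (metis PowD add.commute card_Diff_subset card_mono finite_subset le_add_diff_inverse)
    then show "((-1) ^ card (E - S) when d' = ?m S) = (-1 :: int) ^ card E * ((-1) ^ card S when d' = ?m S)"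
      by (simp add: power_add mult_when when_def flip: power_mult_distrib)
  qed
  finally show ?thesis
    unfolding lookup_edge_poly[OF assms(1)] by (simp add: sum_distrib_left)
qed

lemma lookup_edge_poly_eq_0:
  assumes "finite E" "inc_degree E s t x < d x"
  shows "lookup (edge_poly E s t) d = 0"
  unfolding lookup_edge_poly[OF assms(1)]
proof (intro sum.neutral ballI)
  fix S assume "S \<in> Pow E"
  then have S: "S \<subseteq> E" by simp
  then have "(\<Sum>e\<in>S. unit_exp (s e) x) \<le> (\<Sum>e\<in>E. unit_exp (s e) x)"
       "(\<Sum>e\<in>E-S. unit_exp (t e) x) \<le> (\<Sum>e\<in>E. unit_exp (t e) x)"
    using assms(1) by (auto intro!: sum_mono2)
  then have "((\<Sum>e\<in>S. unit_exp (s e)) + (\<Sum>e\<in>E - S. unit_exp (t e))) x < d x"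
    using assms(2) by (simp add: inc_degree_def sum_fun_apply sum.distrib)
  then have "d \<noteq> (\<Sum>e\<in>S. unit_exp (s e)) + (\<Sum>e\<in>E - S. unit_exp (t e))"
    by (metis less_irrefl)
  then show "((-1) ^ card S when d = (\<Sum>e\<in>S. unit_exp (s e)) + (\<Sum>e\<in>E - S. unit_exp (t e))) = 0"
    by (simp only: when_simps)
qed

lemma lookup_Var_times: "lookup (Var x * f) d = (if d x = 0 then 0 else lookup f (d(x := d x - 1)))"
proof -
  have "unit_exp x \<le> d \<longleftrightarrow> d x \<noteq> 0" by (auto simp: le_fun_def unit_exp_def)
  moreover have "d - unit_exp x = d(x := d x - 1)" by (auto simp: unit_exp_def)
  ultimately show ?thesis by (auto simp: Var_def lookup_single_times)
qed

text \<open>Substituting \<open>x + t\<close> for every variable \<open>x\<close> does not change a product of differences of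
  variables, so the sum of its partial derivatives vanishes.\<close>

lemma sum_partial_derivatives_edge_poly:
  assumes "finite E" "finite V" "\<And>e. e \<in> E \<Longrightarrow> s e \<in> V \<and> t e \<in> V"
  shows "(\<Sum>w\<in>V. int (m w + 1) * lookup (edge_poly E s t) (m(w := m w + 1))) = 0"
  using assms(1,3)
proof (induction E arbitrary: m rule: finite_induct)
  case empty
  have "m(w := m w + 1) \<noteq> 0" for w by (metis One_nat_def Suc_eq_plus1 fun_upd_same nat.simps(3) zero_fun_apply)
  then show ?case by (simp add: edge_poly_def lookup_one del: fun_upd_apply)
next
  case (insert e E)
  let ?F = "edge_poly E s t"
  \<comment> \<open>Leibniz rule: differentiating \<open>Var x\<close> yields the coefficient of
    \<open>?F\<close> at \<open>m\<close>; the terms in which \<open>?F\<close> is differentiated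
    cancel by the induction hypothesis at \<open>m(x := m x - 1)\<close>.\<close>
  have *: "(\<Sum>w\<in>V. int (m w + 1) * lookup (Var x * ?F) (m(w := m w + 1))) = lookup ?F m" if "x \<in> V" for x
  proof -
    have "(\<Sum>w\<in>V. int (m w + 1) * lookup (Var x * ?F) (m(w := m w + 1)))
      = (\<Sum>w\<in>V. (if w = x then lookup ?F m else 0) +
          (if m x = 0 then 0 else int ((m(x := m x - 1)) w + 1) * lookup ?F ((m(x := m x - 1))(w := (m(x := m x - 1)) w + 1))))"
      by (intro sum.cong) (auto simp: lookup_Var_times fun_upd_twist fun_upd_idem algebra_simps of_nat_diff)
    also have "\<dots> = lookup ?F m"
      using insert.IH[of "m(x := m x - 1)"] insert.prems assms(2) that
      by (cases "m x = 0") (simp_all add: sum.distrib del: fun_upd_apply)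
    finally show ?thesis .
  qed
  \<comment> \<open>Both ends of \<open>e\<close> contribute the same value, with opposite
    signs.\<close>
  have "edge_poly (insert e E) s t = Var (t e) * ?F - Var (s e) * ?F"
    using insert by (simp add: edge_poly_def algebra_simps)
  then show ?case using *[of "t e"] *[of "s e"] insert.prems
    by (simp add: lookup_minus right_diff_distrib sum_subtractf del: fun_upd_apply)
qed

section \<open>Splitting off the edges at one vertex\<close>

lemma prod_eq_or_eq_uminus:
  fixes f g :: "'a \<Rightarrow> 'r::comm_ring_1"
  assumes "\<And>e. e \<in> B \<Longrightarrow> f e = g e \<or> f e = - g e"
  shows "prod f B = prod g B \<or> prod f B = - prod g B"
  using assms by (induction B rule: infinite_finite_induct) force+

text \<open>Meant for edges at \<open>v\<close>, where it is the end other than \<open>v\<close>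
  and, for an orientation of a graph, agrees with \<open>other_end\<close>.\<close>

definition opposite :: "('e \<Rightarrow> 'v) \<Rightarrow> ('e \<Rightarrow> 'v) \<Rightarrow> 'v \<Rightarrow> 'e \<Rightarrow> 'v" where
  "opposite s t v e = (if s e = v then t e else s e)"

text \<open>Redirecting all edges at \<open>v\<close> towards \<open>v\<close> changes the
  polynomial at most by a sign, which the square removes.\<close>

lemma edge_poly_split_square:
  assumes "finite E" "B = {e \<in> E. s e = v \<or> t e = v}" "\<And>e. e \<in> B \<Longrightarrow> s e \<noteq> t e"
  shows "(lookup (edge_poly E s t) d)\<^sup>2
    = (lookup (edge_poly (E - B) s t * (\<Prod>e\<in>B. Var v - Var (opposite s t v e))) d)\<^sup>2"
proof -
  have "(\<Prod>e\<in>B. Var (t e) - Var (s e)) = (\<Prod>e\<in>B. Var v - Var (opposite s t v e))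
      \<or> (\<Prod>e\<in>B. Var (t e) - Var (s e)) = - (\<Prod>e\<in>B. Var v - Var (opposite s t v e))"
    by (rule prod_eq_or_eq_uminus) (auto simp: assms(2) opposite_def)
  moreover have "edge_poly E s t = edge_poly (E - B) s t * (\<Prod>e\<in>B. Var (t e) - Var (s e))"
    unfolding edge_poly_def using assms(1,2) by (intro prod.subset_diff) auto
  ultimately show ?thesis by auto
qed

lemma var_free_edge_poly:
  assumes "\<And>e. e \<in> E \<Longrightarrow> s e \<noteq> v \<and> t e \<noteq> v"
  shows "var_free v (edge_poly E s t)"
  unfolding edge_poly_def using assms by (intro var_free_prod var_free_diff var_free_Var) auto

text \<open>An exponent equal to the number of edges at \<open>v\<close> forces the end
  \<open>v\<close> at each of them, which amounts to deleting \<open>v\<close>.\<close>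

lemma edge_poly_top_coeff_square:
  assumes "finite E" "B = {e \<in> E. s e = v \<or> t e = v}" "\<And>e. e \<in> B \<Longrightarrow> s e \<noteq> t e" "d v = card B"
  shows "(lookup (edge_poly E s t) d)\<^sup>2 = (lookup (edge_poly (E - B) s t) (d(v := 0)))\<^sup>2"
proof -
  have "finite B" using assms(1,2) by simp
  then have empty: "{S. S \<subseteq> B \<and> card B = card S + d v} = {{}}"
    using assms(4) by (auto dest: finite_subset)
  have "lookup (edge_poly (E - B) s t * (\<Prod>e\<in>B. Var v - Var (opposite s t v e))) d
    = lookup (edge_poly (E - B) s t) (d(v := 0))"
  proof (subst lookup_times_prod_Var_diff)
    show "var_free v (edge_poly (E - B) s t)" using assms(2) by (intro var_free_edge_poly) simp
    show "opposite s t v e \<noteq> v" if "e \<in> B" for e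
      using that assms(3)[OF that] assms(2) by (auto simp: opposite_def)
  qed (simp_all add: empty \<open>finite B\<close>)
  then show ?thesis using edge_poly_split_square[OF assms(1-3)] by simp
qed


section \<open>Exchanging the two distinguished vertices\<close>

text \<open>The exponent that defines N(z, u). It is 0 outside \<open>V\<close>, so removing a
  vertex from \<open>V\<close> only resets the exponent there.\<close>

definition root_exp :: "nat \<Rightarrow> 'v set \<Rightarrow> 'v \<Rightarrow> 'v \<Rightarrow> 'v \<Rightarrow> nat" where
  "root_exp k V z u = (\<lambda>w. if w \<in> V then if w = u then 2 * k else if w = z then 0 else k else 0)"

text \<open>The two exponents add up to the degree vector, so they are exchanged by complementing
  the choice at every edge.\<close>

lemma root_coeff_swap:
  assumes "finite E" "inc_degree E s t = (\<lambda>w. if w \<in> V then 2 * k else 0)" "z \<noteq> u"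
  shows "(lookup (edge_poly E s t) (root_exp k V z u))\<^sup>2 = (lookup (edge_poly E s t) (root_exp k V u z))\<^sup>2"
proof -
  have "root_exp k V z u + root_exp k V u z = inc_degree E s t"
    using assms(2,3) by (auto simp: root_exp_def)
  from lookup_edge_poly_complement[OF assms(1) this] show ?thesis
    by (simp add: power_mult_distrib flip: power_mult)
qed

text \<open>The exponents \<open>d j\<close>, with \<open>j\<close> at \<open>z\<close> and
  \<open>k - j\<close> at \<open>z'\<close>, lead from N(z, u) to N(z', u). In the derivative
  identity only two terms survive modulo \<open>k + 1\<close>, with factors \<open>Suc j\<close> and
  \<open>k - j\<close>; the latter is congruent to \<open>- Suc j\<close>, so consecutive
  coefficients agree.\<close>

lemma root_coeff_move_zero:
  assumes E: "finite E" and V: "finite V" "\<And>e. e \<in> E \<Longrightarrow> s e \<in> V \<and> t e \<in> V"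
    and deg: "inc_degree E s t = (\<lambda>w. if w \<in> V then 2 * k else 0)" and p: "prime (k + 1)"
    and zu: "z \<in> V" "z' \<in> V" "u \<in> V" "z \<noteq> u" "z' \<noteq> u"
  shows "[lookup (edge_poly E s t) (root_exp k V z u) = lookup (edge_poly E s t) (root_exp k V z' u)] (mod int (k + 1))"
proof (cases "z = z'")
  case zz: False
  define d where "d j = (root_exp k V z u)(z := j, z' := k - j)" for j
  define c where "c j = lookup (edge_poly E s t) (d j)" for j
  have step: "[c (Suc j) = c j] (mod int (k + 1))" if j: "j < k" for j
  proof -
    \<comment> \<open>The exponents at \<open>z\<close> and \<open>z'\<close> add up to
      \<open>k - 1\<close>: raising the one at \<open>z\<close> gives \<open>d (Suc j)\<close>,
      raising the one at \<open>z'\<close> gives \<open>d j\<close>.\<close>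
    define m where "m = (root_exp k V z u)(z := j, z' := k - Suc j)"
    define g where "g w = int (m w + 1) * lookup (edge_poly E s t) (m(w := m w + 1))" for w
    have "sum g V = 0"
      unfolding g_def using sum_partial_derivatives_edge_poly[OF E V(1), of s t m] V(2) by blast
    moreover have "sum g V = g z + g z' + sum g (V - {z, z'})"
      using zu zz V(1) by (simp add: sum.subset_diff[of "{z, z'}" V] add.commute)
    moreover have "int (k + 1) dvd sum g (V - {z, z'})"
    proof (rule dvd_sum)
      fix w assume w: "w \<in> V - {z, z'}"
      show "int (k + 1) dvd g w"
      proof (cases "w = u")
        case True
        \<comment> \<open>The exponent \<open>2 * k + 1\<close> at \<open>u\<close> exceeds the
          degree.\<close>
        then have "lookup (edge_poly E s t) (m(w := m w + 1)) = 0"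
          using w zu by (intro lookup_edge_poly_eq_0[OF E, of _ _ u]) (auto simp: deg m_def root_exp_def)
        then show ?thesis by (simp add: g_def)
      next
        case False
        \<comment> \<open>Raising the exponent \<open>k\<close> produces the derivative factor
          \<open>k + 1\<close>, which is the modulus.\<close>
        then have "m w = k" using w by (auto simp: m_def root_exp_def)
        then show ?thesis by (simp add: g_def)
      qed
    qed
    moreover have "g z = int (Suc j) * c (Suc j)"
    proof -
      have "m(z := m z + 1) = d (Suc j)" using zz by (auto simp: m_def d_def)
      then show ?thesis using zz by (simp add: g_def c_def m_def)
    qed
    moreover have "g z' = (int (k + 1) - int (Suc j)) * c j"
    proof -
      have "m(z' := m z' + 1) = d j" using zz j by (simp add: m_def d_def Suc_diff_Suc)
      then show ?thesis using j by (simp add: g_def c_def m_def of_nat_diff)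
    qed
    ultimately have "int (k + 1) dvd int (Suc j) * c (Suc j) + (int (k + 1) - int (Suc j)) * c j"
      by (metis add_0_left dvd_add_left_iff dvd_0_right)
    then have "int (k + 1) dvd int (Suc j) * (c (Suc j) - c j) + int (k + 1) * c j"
      by (simp add: algebra_simps)
    then have "int (k + 1) dvd int (Suc j) * (c (Suc j) - c j)"
      using dvd_add_left_iff dvd_triv_left by blast
    moreover have "coprime (int (k + 1)) (int (Suc j))"
      using p j by (simp only: coprime_int_iff, intro prime_imp_coprime) (auto dest: dvd_imp_le)
    ultimately show ?thesis
      by (simp add: cong_iff_dvd_diff coprime_dvd_mult_right_iff)
  qed
  have "[c j = c 0] (mod int (k + 1))" if "j \<le> k" for j
    using that
  proof (induction j)
    case (Suc j)
    then show ?case using cong_trans[OF step[of j]] by simp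
  qed simp
  from this[of k] have "[c 0 = c k] (mod int (k + 1))" by (simp add: cong_sym)
  moreover have "d 0 = root_exp k V z u" "d k = root_exp k V z' u"
    using zu zz by (auto simp: d_def root_exp_def)
  ultimately show ?thesis by (simp add: c_def)
qed simp

text \<open>Moving the zero changes the first vertex; between two swaps it changes the second, which
  requires \<open>z \<noteq> u'\<close>. If \<open>z = u'\<close>, one swap already puts
  \<open>u'\<close> in second place.\<close>

lemma root_coeff_independent:
  assumes "finite E" "finite V" "\<And>e. e \<in> E \<Longrightarrow> s e \<in> V \<and> t e \<in> V"
    and "inc_degree E s t = (\<lambda>w. if w \<in> V then 2 * k else 0)" and "prime (k + 1)"
    and zu: "z \<in> V" "u \<in> V" "z \<noteq> u" "z' \<in> V" "u' \<in> V" "z' \<noteq> u'"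
  shows "[(lookup (edge_poly E s t) (root_exp k V z u))\<^sup>2 = (lookup (edge_poly E s t) (root_exp k V z' u'))\<^sup>2] (mod int (k + 1))"
proof -
  define Q where "Q z u = (lookup (edge_poly E s t) (root_exp k V z u))\<^sup>2" for z u
  have swap: "Q a b = Q b a" if "a \<noteq> b" for a b
    unfolding Q_def using root_coeff_swap[OF assms(1,4) that] .
  have move: "[Q a b = Q a' b] (mod int (k + 1))" if "a \<in> V" "a' \<in> V" "b \<in> V" "a \<noteq> b" "a' \<noteq> b" for a a' b
    unfolding Q_def using root_coeff_move_zero[OF assms(1-5) that] by (rule cong_pow)
  show ?thesis
  proof (cases "z = u'")
    case True
    then show ?thesis using move[of u z' u'] swap[of z u] zu unfolding Q_def[symmetric] by auto
  next
    case False
    have "[Q z u = Q z u'] (mod int (k + 1))"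
      using move[of u u' z] swap[of z u] swap[of z u'] zu False by auto
    also have "[Q z u' = Q z' u'] (mod int (k + 1))"
      using move[of z z' u'] zu False by auto
    finally show ?thesis by (simp add: Q_def)
  qed
qed


section \<open>Permanents with repeated rows\<close>

text \<open>Such a bijection matches each class of rows with the class of columns of the same label,
  independently for each label. It is used with vertices as labels for permanents and with truth
  values for matchings.\<close>

lemma card_label_preserving_bij:
  assumes "finite R" "finite C" "finite A" "l ` R \<subseteq> A"
    and "\<And>a. card {r \<in> R. l r = a} = card {c \<in> C. m c = a}"
  shows "card {f \<in> R \<rightarrow>\<^sub>E C. bij_betw f R C \<and> (\<forall>r\<in>R. m (f r) = l r)}
    = (\<Prod>a\<in>A. fact (card {r \<in> R. l r = a}))"
  using assms(1,2,4,5)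
proof (induction R arbitrary: C rule: finite_induct)
  case empty
  have "C = {}"
  proof (rule ccontr)
    assume "C \<noteq> {}"
    then obtain c where "c \<in> C" by auto
    then have "card {x \<in> C. m x = m c} \<noteq> 0" using empty.prems(1) by auto
    then show False using empty.prems(3)[of "m c"] by simp
  qed
  then have "{f \<in> {} \<rightarrow>\<^sub>E C. bij_betw f {} C \<and> (\<forall>r\<in>{}. m (f r) = l r)} = {\<lambda>_. undefined}"
    unfolding bij_betw_def by simp
  then show ?case by simp
next
  case (insert x R)
  define L where "L R C = {f \<in> R \<rightarrow>\<^sub>E C. bij_betw f R C \<and> (\<forall>r\<in>R. m (f r) = l r)}" for R C
  define Cx where "Cx = {c \<in> C. m c = l x}"
  have fL: "finite (L R (C - {c}))" for c
  proof (rule finite_subset)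
    show "L R (C - {c}) \<subseteq> R \<rightarrow>\<^sub>E (C - {c})" by (auto simp: L_def)
    show "finite (R \<rightarrow>\<^sub>E (C - {c}))" using insert by (intro finite_PiE) simp_all
  qed
  \<comment> \<open>Sort the bijections by the image \<open>c\<close> of \<open>x\<close>. Removing
    \<open>x\<close> and \<open>c\<close>, which have the same label, keeps the class sizes
    equal.\<close>
  have L_insert: "L (insert x R) C = (\<Union>c\<in>Cx. (\<lambda>g. g(x := c)) ` L R (C - {c}))"
  proof (intro equalityI subsetI)
    fix f assume f: "f \<in> L (insert x R) C"
    \<comment> \<open>Resetting the value at \<open>x\<close> makes the restriction to
      \<open>R\<close> extensional.\<close>
    define g where "g = f(x := undefined)"
    have fg: "f = g(x := f x)" by (simp add: g_def)
    have "bij_betw f R (C - {f x})"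
      using f insert.hyps by (auto simp: L_def bij_betw_def inj_on_def)
    then have "bij_betw g R (C - {f x})"
      using insert.hyps by (subst bij_betw_cong[of _ _ f]) (auto simp: g_def)
    moreover have "g \<in> R \<rightarrow>\<^sub>E (C - {f x})"
      using f insert.hyps calculation by (auto simp: L_def g_def PiE_def extensional_def bij_betw_def)
    ultimately have "g \<in> L R (C - {f x})"
      using f insert.hyps by (auto simp: L_def g_def)
    moreover have "f x \<in> Cx" using f by (auto simp: L_def Cx_def)
    ultimately show "f \<in> (\<Union>c\<in>Cx. (\<lambda>g. g(x := c)) ` L R (C - {c}))" using fg by blast
  next
    fix f assume "f \<in> (\<Union>c\<in>Cx. (\<lambda>g. g(x := c)) ` L R (C - {c}))"
    then obtain c g where c: "c \<in> Cx" and g: "g \<in> L R (C - {c})" and f: "f = g(x := c)" by auto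
    have "bij_betw f R (C - {c})"
      using g insert.hyps by (subst bij_betw_cong[of _ _ g]) (auto simp: f L_def)
    then have "bij_betw f (R \<union> {x}) ((C - {c}) \<union> {c})"
      using insert.hyps by (intro bij_betw_combine) (auto simp: f bij_betw_def)
    then have "bij_betw f (insert x R) C"
      using c by (simp add: Cx_def insert_absorb)
    then show "f \<in> L (insert x R) C"
      using c g insert.hyps by (auto simp: L_def f Cx_def PiE_def extensional_def)
  qed
  have card_c: "card ((\<lambda>g. g(x := c)) ` L R (C - {c})) = (\<Prod>a\<in>A. fact (card {r \<in> R. l r = a}))"
    if c: "c \<in> Cx" for c
  proof -
    have "inj_on (\<lambda>g. g(x := c)) (L R (C - {c}))"
    proof (rule inj_onI)
      fix g g' assume g: "g \<in> L R (C - {c})" "g' \<in> L R (C - {c})" and eq: "g(x := c) = g'(x := c)"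
      have "g x = undefined" "g' x = undefined"
        using g insert.hyps by (auto simp: L_def PiE_def extensional_def)
      then show "g = g'" using eq by (metis fun_upd_triv fun_upd_upd)
    qed
    then have "card ((\<lambda>g. g(x := c)) ` L R (C - {c})) = card (L R (C - {c}))"
      by (rule card_image)
    also have "\<dots> = (\<Prod>a\<in>A. fact (card {r \<in> R. l r = a}))"
      unfolding L_def
    proof (rule insert.IH)
      fix a
      have eq: "card {r \<in> insert x R. l r = a} = card {c \<in> C. m c = a}" by (rule insert.prems(3))
      have "{r \<in> insert x R. l r = a} = (if l x = a then insert x {r \<in> R. l r = a} else {r \<in> R. l r = a})"
        by auto
      moreover have "{c' \<in> C - {c}. m c' = a} = (if l x = a then {c \<in> C. m c = a} - {c} else {c \<in> C. m c = a})"
        using c by (auto simp: Cx_def)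
      ultimately show "card {r \<in> R. l r = a} = card {c' \<in> C - {c}. m c' = a}"
        using eq c insert.hyps insert.prems(1) by (auto simp: Cx_def card_Diff_singleton_if split: if_splits)
    qed (use insert.prems in auto)
    finally show ?thesis .
  qed
  have "card (L (insert x R) C) = card Cx * (\<Prod>a\<in>A. fact (card {r \<in> R. l r = a}))"
  proof -
    have "card (\<Union>c\<in>Cx. (\<lambda>g. g(x := c)) ` L R (C - {c})) = (\<Sum>c\<in>Cx. card ((\<lambda>g. g(x := c)) ` L R (C - {c})))"
    proof (rule card_UN_disjoint)
      show "\<forall>i\<in>Cx. \<forall>j\<in>Cx. i \<noteq> j \<longrightarrow>
          (\<lambda>g. g(x := i)) ` L R (C - {i}) \<inter> (\<lambda>g. g(x := j)) ` L R (C - {j}) = {}"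
        by (auto dest: fun_cong[where x = x])
    qed (use insert.prems fL in \<open>auto simp: Cx_def\<close>)
    with L_insert card_c show ?thesis by simp
  qed
  also have "card Cx = card {r \<in> insert x R. l r = l x}"
    using insert.prems(3)[of "l x"] by (simp add: Cx_def)
  also have "{r \<in> insert x R. l r = l x} = insert x {r \<in> R. l r = l x}" by auto
  also have "card \<dots> = Suc (card {r \<in> R. l r = l x})"
    using insert.hyps by simp
  also have "Suc (card {r \<in> R. l r = l x}) * (\<Prod>a\<in>A. fact (card {r \<in> R. l r = a}))
      = (\<Prod>a\<in>A. fact (card {r \<in> insert x R. l r = a}))"
  proof -
    have xA: "l x \<in> A" using insert.prems by simp
    have "{r \<in> insert x R. l r = a} = (if a = l x then insert x {r \<in> R. l r = a} else {r \<in> R. l r = a})" for a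
      by auto
    then have "(\<Prod>a\<in>A. fact (card {r \<in> insert x R. l r = a}) :: nat)
        = (\<Prod>a\<in>A. (if a = l x then Suc (card {r \<in> R. l r = a}) else 1) * fact (card {r \<in> R. l r = a}))"
      using insert.hyps by (intro prod.cong) (auto simp: algebra_simps)
    also have "\<dots> = Suc (card {r \<in> R. l r = l x}) * (\<Prod>a\<in>A. fact (card {r \<in> R. l r = a}))"
      using assms(3) xA by (simp add: prod.distrib)
    finally show ?thesis by simp
  qed
  finally show ?case by (simp add: L_def)
qed

text \<open>Forgetting which copy of a row is used (\<open>\<Phi>\<close>) turns a bijection into an
  assignment of a row of \<open>A\<close> to every column, each row being used \<open>k\<close>
  times. Every such assignment arises from the same number of bijections, one factor
  \<open>fact k\<close> per row of \<open>A\<close>.\<close>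

lemma permanent_repeated_rows:
  fixes C :: "'c set" and W :: "'r set"
  assumes "finite C" "finite W"
  shows "permanent (W \<times> {..<k}) C (\<lambda>(v, i). A v)
    = fact k ^ card W * (\<Sum>h | h \<in> C \<rightarrow>\<^sub>E W \<and> (\<forall>w\<in>W. card {e \<in> C. h e = w} = k). \<Prod>e\<in>C. A (h e) e)"
proof -
  define R where "R = W \<times> {..<k}"
  define F where "F = {f \<in> R \<rightarrow>\<^sub>E C. bij_betw f R C}"
  define H where "H = {h \<in> C \<rightarrow>\<^sub>E W. \<forall>w\<in>W. card {e \<in> C. h e = w} = k}"
  define \<Phi> where "\<Phi> f = restrict (\<lambda>e. fst (inv_into R f e)) C" for f :: "'r \<times> nat \<Rightarrow> 'c"
  have "finite R" using assms by (simp add: R_def)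
  moreover have "finite (R \<rightarrow>\<^sub>E C)" "finite (C \<rightarrow>\<^sub>E W)"
    using assms \<open>finite R\<close> by (intro finite_PiE; simp)+
  moreover have "F \<subseteq> R \<rightarrow>\<^sub>E C" "H \<subseteq> C \<rightarrow>\<^sub>E W" by (auto simp: F_def H_def)
  ultimately have fin: "finite R" "finite F" "finite H" using finite_subset by blast+
  have \<Phi>: "\<Phi> f (f r) = fst r" if "f \<in> F" "r \<in> R" for f r
    using that by (auto simp: F_def \<Phi>_def bij_betw_def)
  have \<Phi>H: "\<Phi> f \<in> H" if f: "f \<in> F" for f
  proof -
    have bij: "bij_betw f R C" using f by (simp add: F_def)
    have "card {e \<in> C. \<Phi> f e = w} = k" if w: "w \<in> W" for w
    proof -
      have "{e \<in> C. \<Phi> f e = w} = f ` ({w} \<times> {..<k})"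
        using w \<Phi>[OF f] bij unfolding bij_betw_def by (fastforce simp: R_def)
      also have "card \<dots> = k"
        using bij w by (subst card_image) (auto simp: R_def card_cartesian_product bij_betw_def intro: inj_on_subset)
      finally show ?thesis .
    qed
    moreover have "\<Phi> f \<in> C \<rightarrow>\<^sub>E W"
      using \<Phi>[OF f] bij unfolding bij_betw_def by (auto simp: R_def \<Phi>_def inv_into_into) 
    ultimately show ?thesis by (simp add: H_def)
  qed
  \<comment> \<open>The bijections over \<open>h\<close> are those preserving the labels
    \<open>fst\<close> of rows and \<open>h\<close> of columns, so the preceding count
    applies.\<close>
  have fib: "{f \<in> F. \<Phi> f = h} = {f \<in> R \<rightarrow>\<^sub>E C. bij_betw f R C \<and> (\<forall>r\<in>R. h (f r) = fst r)}" if h: "h \<in> H" for h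
  proof (intro equalityI subsetI)
    fix f assume "f \<in> {f \<in> F. \<Phi> f = h}"
    then show "f \<in> {f \<in> R \<rightarrow>\<^sub>E C. bij_betw f R C \<and> (\<forall>r\<in>R. h (f r) = fst r)}"
      using \<Phi>[of f] by (auto simp: F_def)
  next
    fix f assume f: "f \<in> {f \<in> R \<rightarrow>\<^sub>E C. bij_betw f R C \<and> (\<forall>r\<in>R. h (f r) = fst r)}"
    then have fF: "f \<in> F" by (simp add: F_def)
    have "\<Phi> f e = h e" for e
    proof (cases "e \<in> C")
      case True
      then obtain r where "r \<in> R" "e = f r" using f by (auto simp: bij_betw_def)
      then show ?thesis using f \<Phi>[OF fF] by auto
    next
      case False
      then show ?thesis using h by (auto simp: H_def \<Phi>_def PiE_def extensional_def)
    qed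
    with fF show "f \<in> {f \<in> F. \<Phi> f = h}" by auto
  qed
  have card_fib: "card {f \<in> F. \<Phi> f = h} = fact k ^ card W" if h: "h \<in> H" for h
  proof -
    have Rfib: "{r \<in> R. fst r = a} = (if a \<in> W then {a} \<times> {..<k} else {})" for a
      by (auto simp: R_def)
    have "card {f \<in> F. \<Phi> f = h} = (\<Prod>a\<in>W. fact (card {r \<in> R. fst r = a}))"
      unfolding fib[OF h]
    proof (rule card_label_preserving_bij)
      fix a
      show "card {r \<in> R. fst r = a} = card {c \<in> C. h c = a}"
      proof (cases "a \<in> W")
        case True
        then show ?thesis using h by (simp add: Rfib H_def card_cartesian_product)
      next
        case False
        then have "{c \<in> C. h c = a} = {}" using h by (auto simp: H_def)
        then show ?thesis using False by (simp only: Rfib if_False card.empty)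
      qed
    qed (use assms fin in \<open>auto simp: R_def\<close>)
    then show ?thesis by (simp add: Rfib card_cartesian_product)
  qed
  have val: "(\<Prod>r\<in>R. A (fst r) (f r)) = (\<Prod>e\<in>C. A (\<Phi> f e) e)" if f: "f \<in> F" for f
  proof -
    have "bij_betw f R C" using f by (simp add: F_def)
    then have "(\<Prod>e\<in>C. A (\<Phi> f e) e) = (\<Prod>r\<in>R. A (\<Phi> f (f r)) (f r))"
      by (rule prod.reindex_bij_betw[symmetric])
    then show ?thesis using \<Phi>[OF f] by simp
  qed
  have "permanent R C (\<lambda>(v, i). A v) = (\<Sum>f\<in>F. \<Prod>e\<in>C. A (\<Phi> f e) e)"
    unfolding permanent_def F_def[symmetric] by (intro sum.cong) (auto simp: case_prod_beta val)
  also have "\<dots> = (\<Sum>h\<in>H. \<Sum>f | f \<in> F \<and> \<Phi> f = h. \<Prod>e\<in>C. A (\<Phi> f e) e)"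
    using fin \<Phi>H by (intro sum.group[symmetric]) auto
  also have "\<dots> = (\<Sum>h\<in>H. fact k ^ card W * (\<Prod>e\<in>C. A (h e) e))"
    using card_fib by (intro sum.cong) auto
  finally show ?thesis by (simp add: R_def H_def sum_distrib_left)
qed


section \<open>Perfect matchings and their transversals\<close>

text \<open>Transitions over an arbitrary set in place of the edges at a vertex, so that they can be
  counted without a graph.\<close>

definition matchings :: "'e set \<Rightarrow> 'e set set set" where
  "matchings B = {\<tau>. partition_on B \<tau> \<and> (\<forall>P\<in>\<tau>. card P = 2)}"

definition transversals :: "'e set \<Rightarrow> 'e set set \<Rightarrow> 'e set set" where
  "transversals B \<tau> = {S. S \<subseteq> B \<and> (\<forall>P\<in>\<tau>. \<exists>!e. e \<in> P \<inter> S)}"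

text \<open>The sign of the monomial of \<open>S\<close> in the product of differences over \<tau>
  in which \<open>f P\<close> is the positive member of the pair \<open>P\<close>.\<close>

definition orient_sign :: "('e set \<Rightarrow> 'e) \<Rightarrow> 'e set set \<Rightarrow> 'e set \<Rightarrow> int" where
  "orient_sign f \<tau> S = (\<Prod>P\<in>\<tau>. if f P \<in> S then 1 else - 1)"

lemma partition_on_block_eq:
  assumes "partition_on B \<tau>" "P \<in> \<tau>" "Q \<in> \<tau>" "e \<in> P" "e \<in> Q"
  shows "P = Q"
  using disjointD[OF partition_onD2[OF assms(1)] assms(2,3)] assms(4,5) by blast

lemma partition_on_ex_block:
  assumes "partition_on B \<tau>" "e \<in> B"
  obtains P where "P \<in> \<tau>" "e \<in> P"
  using assms by (auto simp: partition_on_def)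

lemma transversal_ex1:
  assumes "S \<in> transversals B \<tau>" "P \<in> \<tau>"
  shows "\<exists>!e. e \<in> P \<inter> S"
proof -
  have "\<forall>P\<in>\<tau>. \<exists>!e. e \<in> P \<inter> S" using assms(1) unfolding transversals_def mem_Collect_eq by (rule conjunct2)
  then show ?thesis using assms(2) by (rule bspec)
qed

lemma transversal_pair:
  assumes "S \<in> transversals B \<tau>" "{a, b} \<in> \<tau>" "a \<noteq> b"
  shows "b \<notin> S \<longleftrightarrow> a \<in> S"
proof -
  have *: "\<exists>!e. e \<in> {a, b} \<inter> S" by (rule transversal_ex1[OF assms(1,2)])
  show ?thesis
  proof (cases "a \<in> S")
    case True
    have "b \<notin> S"
    proof
      assume "b \<in> S"
      then have "a \<in> {a, b} \<inter> S" "b \<in> {a, b} \<inter> S" using True by auto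
      from trans[OF sym[OF the1_equality[OF * this(1)]] the1_equality[OF * this(2)]]
      show False using assms(3) by simp
    qed
    then show ?thesis using True by simp
  next
    case False
    then show ?thesis using ex1_implies_ex[OF *] by auto
  qed
qed

lemma matching_finite:
  assumes "\<tau> \<in> matchings B" "finite B"
  shows "finite \<tau>" "P \<in> \<tau> \<Longrightarrow> finite P" "P \<in> \<tau> \<Longrightarrow> card P = 2" "\<Union>\<tau> = B"
proof -
  have \<tau>: "partition_on B \<tau>" and two: "\<And>P. P \<in> \<tau> \<Longrightarrow> card P = 2"
    using assms(1) by (simp_all add: matchings_def)
  show "finite \<tau>" using finite_elements[OF assms(2) \<tau>] .
  show "\<Union>\<tau> = B" using partition_onD1[OF \<tau>] ..
  show "P \<in> \<tau> \<Longrightarrow> card P = 2" by (rule two)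
  then show "P \<in> \<tau> \<Longrightarrow> finite P" by (metis card.infinite zero_neq_numeral)
qed

lemma bij_betw_choice_transversal:
  assumes "\<tau> \<in> matchings B" "S \<in> transversals B \<tau>"
  shows "bij_betw (\<lambda>P. THE e. e \<in> P \<inter> S) \<tau> S" and "P \<in> \<tau> \<Longrightarrow> (THE e. e \<in> P \<inter> S) \<in> P \<inter> S"
proof -
  have \<tau>: "partition_on B \<tau>" using assms by (simp add: matchings_def)
  let ?c = "\<lambda>P. THE e. e \<in> P \<inter> S"
  have ex1: "\<exists>!e. e \<in> P \<inter> S" if "P \<in> \<tau>" for P
    using assms(2) that by (simp add: transversals_def)
  have the: "?c P \<in> P \<inter> S" if "P \<in> \<tau>" for P
    by (rule theI'[OF ex1[OF that]])
  have eq: "?c P = e" if "P \<in> \<tau>" "e \<in> P" "e \<in> S" for P e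
    using the1_equality[OF ex1[OF that(1)]] that by blast
  have "inj_on ?c \<tau>"
  proof (rule inj_onI)
    fix P Q assume PQ: "P \<in> \<tau>" "Q \<in> \<tau>" "?c P = ?c Q"
    then have "?c P \<in> P" "?c P \<in> Q" using the[of P] the[of Q] by auto
    then show "P = Q" using partition_on_block_eq[OF \<tau> PQ(1,2)] by blast
  qed
  moreover have "?c ` \<tau> = S"
  proof (intro equalityI subsetI)
    fix e assume "e \<in> ?c ` \<tau>" then show "e \<in> S" using the by auto
  next
    fix e assume e: "e \<in> S"
    then have "e \<in> B" using assms by (auto simp: transversals_def)
    then obtain P where "P \<in> \<tau>" "e \<in> P" using partition_on_ex_block[OF \<tau>] by metis
    then have "e = ?c P" "P \<in> \<tau>" using eq[of P e] e by (simp_all only:)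
    then show "e \<in> ?c ` \<tau>" by (rule image_eqI)
  qed
  ultimately show "bij_betw ?c \<tau> S" by (simp add: bij_betw_def)
  show "P \<in> \<tau> \<Longrightarrow> ?c P \<in> P \<inter> S" by (rule the)
qed

lemma card_matching:
  assumes "\<tau> \<in> matchings B" "finite B"
  shows "card B = 2 * card \<tau>"
proof -
  note fin = matching_finite[OF assms]
  have "disjoint \<tau>" using assms by (auto simp: matchings_def dest: partition_onD2)
  then have "2 * card \<tau> = card (\<Union>\<tau>)"
    using fin assms(2) by (intro card_partition) (simp_all add: disjointD)
  then show ?thesis by (simp add: fin(4))
qed

lemma card_transversal:
  assumes "\<tau> \<in> matchings B" "finite B" "S \<in> transversals B \<tau>"
  shows "card B = 2 * card S"
  using card_matching[OF assms(1,2)] bij_betw_same_card[OF bij_betw_choice_transversal(1)[OF assms(1,3)]] by simp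

text \<open>Expanding the product picks one member of each pair. Such choice functions correspond to
  the transversals through their images.\<close>

lemma prod_matching_diff:
  fixes y :: "'e \<Rightarrow> 'r::comm_ring_1"
  assumes "\<tau> \<in> matchings B" "finite B" and fg: "\<And>P. P \<in> \<tau> \<Longrightarrow> {f P, g P} = P" "\<And>P. P \<in> \<tau> \<Longrightarrow> f P \<noteq> g P"
  shows "(\<Prod>P\<in>\<tau>. y (f P) - y (g P)) = (\<Sum>S\<in>transversals B \<tau>. of_int (orient_sign f \<tau> S) * (\<Prod>e\<in>S. y e))"
proof -
  note fin = matching_finite[OF assms(1,2)]
  have \<tau>: "partition_on B \<tau>" using assms by (simp add: matchings_def)
  define c where "c P e = (if e = f P then 1 else - 1 :: 'r)" for P e
  define h where "h S = restrict (\<lambda>P. THE e. e \<in> P \<inter> S) \<tau>" for S :: "'e set"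
  \<comment> \<open>Since the blocks are disjoint, a choice function can be recovered from its
    image.\<close>
  have img: "P \<inter> x ` \<tau> = {x P}" if "x \<in> PiE \<tau> (\<lambda>P. P)" "P \<in> \<tau>" for x P
  proof -
    have "Q = P" if Q: "Q \<in> \<tau>" "x Q \<in> P" for Q
      using partition_on_block_eq[OF \<tau> Q(1) \<open>P \<in> \<tau>\<close> PiE_mem[OF \<open>x \<in> _\<close> Q(1)] Q(2)] .
    then show ?thesis using that by (auto dest: PiE_mem)
  qed
  have "(\<Prod>P\<in>\<tau>. y (f P) - y (g P)) = (\<Prod>P\<in>\<tau>. \<Sum>e\<in>P. c P e * y e)"
  proof (rule prod.cong[OF refl])
    fix P assume "P \<in> \<tau>"
    note P = fg[OF this]
    have "(\<Sum>e\<in>P. c P e * y e) = (\<Sum>e\<in>{f P, g P}. c P e * y e)"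
      unfolding P(1) ..
    also have "\<dots> = y (f P) - y (g P)" using P(2) by (simp add: c_def)
    finally show "y (f P) - y (g P) = (\<Sum>e\<in>P. c P e * y e)" ..
  qed
  also have "\<dots> = (\<Sum>x\<in>PiE \<tau> (\<lambda>P. P). \<Prod>P\<in>\<tau>. c P (x P) * y (x P))"
    using fin by (intro prod_sum_PiE) auto
  also have "\<dots> = (\<Sum>S\<in>transversals B \<tau>. of_int (orient_sign f \<tau> S) * (\<Prod>e\<in>S. y e))"
  proof (rule sum.reindex_bij_witness[of _ h "\<lambda>x. x ` \<tau>"])
    fix x assume x: "x \<in> PiE \<tau> (\<lambda>P. P)"
    note im = img[OF x]
    show "h (x ` \<tau>) = x"
    proof
      fix P show "h (x ` \<tau>) P = x P"
        using x im[of P] by (cases "P \<in> \<tau>") (auto simp: h_def PiE_def extensional_def)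
    qed
    have "x ` \<tau> \<subseteq> B" using x fin(4) by (auto dest: PiE_mem)
    moreover have "\<exists>!e. e \<in> P \<inter> x ` \<tau>" if "P \<in> \<tau>" for P
      unfolding im[OF that] by simp
    ultimately show "x ` \<tau> \<in> transversals B \<tau>" by (simp add: transversals_def)
    have inj: "inj_on x \<tau>"
    proof (rule inj_onI)
      fix P Q assume PQ: "P \<in> \<tau>" "Q \<in> \<tau>" "x P = x Q"
      then show "P = Q"
        using partition_on_block_eq[OF \<tau> PQ(1,2) PiE_mem[OF x PQ(1)]] PiE_mem[OF x PQ(2)] by simp
    qed
    have "of_int (orient_sign f \<tau> (x ` \<tau>)) = (\<Prod>P\<in>\<tau>. c P (x P))"
      unfolding orient_sign_def of_int_prod
    proof (rule prod.cong[OF refl])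
      fix P assume P: "P \<in> \<tau>"
      have "f P \<in> P" using fg(1)[OF P] by (metis insertI1)
      then have "f P \<in> x ` \<tau> \<longleftrightarrow> f P \<in> P \<inter> x ` \<tau>" by simp
      then have "f P \<in> x ` \<tau> \<longleftrightarrow> x P = f P" unfolding im[OF P] by auto
      then show "of_int (if f P \<in> x ` \<tau> then 1 else - 1) = c P (x P)" by (auto simp: c_def)
    qed
    then show "of_int (orient_sign f \<tau> (x ` \<tau>)) * (\<Prod>e\<in>x ` \<tau>. y e) = (\<Prod>P\<in>\<tau>. c P (x P) * y (x P))"
      by (simp add: prod.reindex[OF inj] prod.distrib)
  next
    fix S assume S: "S \<in> transversals B \<tau>"
    note bij = bij_betw_choice_transversal[OF assms(1) S]
    show "h S ` \<tau> = S" using bij(1) by (simp add: h_def bij_betw_def)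
    show "h S \<in> PiE \<tau> (\<lambda>P. P)" using bij(2) by (auto simp: h_def)
  qed
  finally show ?thesis .
qed

text \<open>A pair contributes 1 if \<open>S\<close> and \<open>T\<close> pick the same member and
  -1 otherwise, whichever member is \<open>f P\<close>. The pairs of the second kind correspond to
  the elements of \<open>S - T\<close>.\<close>

lemma orient_sign_mult:
  assumes "\<tau> \<in> matchings B" "finite B" and f: "\<And>P. P \<in> \<tau> \<Longrightarrow> f P \<in> P"
    and S: "S \<in> transversals B \<tau>" and T: "T \<in> transversals B \<tau>"
  shows "orient_sign f \<tau> S * orient_sign f \<tau> T = (- 1) ^ card (S - T)"
proof -
  define c where "c P = (THE e. e \<in> P \<inter> S)" for P
  note bij = bij_betw_choice_transversal[OF assms(1) S, folded c_def]
  have "finite S" using S assms(2) by (auto simp: transversals_def intro: finite_subset)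
  have "orient_sign f \<tau> S * orient_sign f \<tau> T = (\<Prod>P\<in>\<tau>. if c P \<in> T then 1 else - 1)"
    unfolding orient_sign_def prod.distrib[symmetric]
  proof (rule prod.cong[OF refl])
    fix P assume P: "P \<in> \<tau>"
    have uS: "\<exists>!e. e \<in> P \<inter> S" and uT: "\<exists>!e. e \<in> P \<inter> T" using S T P by (simp_all add: transversals_def)
    define d where "d = (THE e. e \<in> P \<inter> T)"
    have d: "d \<in> P \<inter> T" unfolding d_def by (rule theI'[OF uT])
    have "e = d" if "e \<in> P \<inter> T" for e
      unfolding d_def using the1_equality[OF uT that] by (rule sym)
    moreover
    have c: "c P \<in> P \<inter> S" by (rule bij(2)[OF P])
    have "e = c P" if "e \<in> P \<inter> S" for e
      unfolding c_def using the1_equality[OF uS that] by (rule sym)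
    ultimately have *: "\<And>e. e \<in> P \<Longrightarrow> e \<in> S \<longleftrightarrow> e = c P" "\<And>e. e \<in> P \<Longrightarrow> e \<in> T \<longleftrightarrow> e = d"
      using c d by (metis IntD2 IntI)+
    have "c P \<in> P" "d \<in> P" using c d by simp_all
    obtain a b where "P = {a, b}"
      using matching_finite(3)[OF assms(1,2) P] by (auto simp: card_2_iff)
    then have "f P \<in> {a, b}" "c P \<in> {a, b}" "d \<in> {a, b}"
      using f[OF P] \<open>c P \<in> P\<close> \<open>d \<in> P\<close> by simp_all
    \<comment> \<open>In a two-element set, \<open>c P\<close> and \<open>d\<close> are equal
      exactly when both or neither equal \<open>f P\<close>.\<close>
    then have "(if f P = c P then 1 else - 1) * (if f P = d then 1 else - 1) = (if c P = d then 1 else - 1 :: int)"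
      by auto
    then show "(if f P \<in> S then 1 else - 1) * (if f P \<in> T then 1 else - 1) = (if c P \<in> T then 1 else - 1 :: int)"
      using *[OF f[OF P]] *(2)[OF \<open>c P \<in> P\<close>] by (simp only:)
  qed
  also have "\<dots> = (\<Prod>e\<in>S. if e \<in> T then 1 else - 1)"
    using prod.reindex_bij_betw[OF bij(1), of "\<lambda>e. if e \<in> T then 1 else - 1 :: int"] by simp
  also have "\<dots> = (- 1) ^ card (S - T)"
    using \<open>finite S\<close> by (simp add: prod.If_cases Diff_eq)
  finally show ?thesis .
qed

text \<open>A matching with transversal \<open>S\<close> is a bijection from \<open>S\<close> to
  \<open>B - S\<close>. For \<open>T\<close> to be a transversal too, it must send
  \<open>S \<inter> T\<close> to the complement of \<open>S \<union> T\<close> and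
  \<open>S - T\<close> to \<open>T - S\<close>; the sizes agree because \<open>S\<close> and
  \<open>T\<close> are halves of \<open>B\<close>.\<close>

lemma card_matchings_common_transversals:
  assumes "finite B" "S \<subseteq> B" "T \<subseteq> B" "card B = 2 * k" "card S = k" "card T = k"
  shows "card {\<tau> \<in> matchings B. S \<in> transversals B \<tau> \<and> T \<in> transversals B \<tau>}
    = fact (card (S \<inter> T)) * fact (card (S - T))"
proof -
  define L where "L = {\<phi> \<in> S \<rightarrow>\<^sub>E (B - S). bij_betw \<phi> S (B - S) \<and> (\<forall>e\<in>S. (\<phi> e \<notin> T) = (e \<in> T))}"
  define \<Psi> where "\<Psi> \<phi> = (\<lambda>e. {e, \<phi> e}) ` S" for \<phi> :: "'a \<Rightarrow> 'a"
  have fin: "finite S" "finite T" using assms finite_subset by auto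
  \<comment> \<open>The label is membership in \<open>T\<close> on \<open>S\<close>, and
    non-membership in \<open>T\<close> on \<open>B - S\<close>.\<close>
  have "card L = (\<Prod>a\<in>UNIV. fact (card {e \<in> S. (e \<in> T) = a}))"
    unfolding L_def
  proof (rule card_label_preserving_bij)
    fix a :: bool
    have "card (S - T) = k - card (S \<inter> T)" "card (T - S) = k - card (S \<inter> T)"
      using assms(5,6) fin by (simp_all add: card_Diff_subset_Int Int_commute)
    moreover have "card (S \<inter> T) \<le> k" using assms(5) fin by (metis Int_lower1 card_mono)
    moreover have "card (B - (S \<union> T)) = card B - card (S \<union> T)"
      using assms fin by (intro card_Diff_subset) auto
    moreover have "card (S \<union> T) + card (S \<inter> T) = 2 * k"
      using card_Un_Int[OF fin] assms by simp
    moreover have "{e \<in> S. e \<in> T} = S \<inter> T" "{e \<in> S. e \<notin> T} = S - T"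
      "{e \<in> B - S. e \<notin> T} = B - (S \<union> T)" "{e \<in> B - S. e \<in> T} = T - S"
      using assms by auto
    ultimately show "card {e \<in> S. (e \<in> T) = a} = card {e \<in> B - S. (e \<notin> T) = a}"
      using assms(4) by (cases a) simp_all
  qed (use fin assms(1) in auto)
  moreover have "{e \<in> S. e \<in> T} = S \<inter> T" "{e \<in> S. e \<notin> T} = S - T" by auto
  ultimately have cardL: "card L = fact (card (S \<inter> T)) * fact (card (S - T))"
    by (simp add: UNIV_bool mult.commute)
  have "bij_betw \<Psi> L {\<tau> \<in> matchings B. S \<in> transversals B \<tau> \<and> T \<in> transversals B \<tau>}"
    unfolding bij_betw_def
  proof (intro conjI inj_onI equalityI subsetI)
    fix \<phi> \<psi> assume \<phi>: "\<phi> \<in> L" "\<psi> \<in> L" and eq: "\<Psi> \<phi> = \<Psi> \<psi>"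
    show "\<phi> = \<psi>"
    proof
      fix e show "\<phi> e = \<psi> e"
      proof (cases "e \<in> S")
        case True
        then have "{e, \<phi> e} \<in> \<Psi> \<psi>" using eq by (auto simp: \<Psi>_def)
        then obtain e' where e': "e' \<in> S" "{e, \<phi> e} = {e', \<psi> e'}" by (auto simp: \<Psi>_def)
        have "\<psi> e' \<notin> S" "\<phi> e \<notin> S" using \<phi> e'(1) True by (auto simp: L_def dest: PiE_mem)
        then show ?thesis using e' True by (auto simp: doubleton_eq_iff)
      qed (use \<phi> in \<open>auto simp: L_def PiE_def extensional_def\<close>)
    qed
  next
    fix \<tau> assume "\<tau> \<in> \<Psi> ` L"
    then obtain \<phi> where \<phi>: "\<phi> \<in> L" and \<tau>: "\<tau> = \<Psi> \<phi>" by auto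
    have bij: "bij_betw \<phi> S (B - S)" and lab: "\<And>e. e \<in> S \<Longrightarrow> \<phi> e \<notin> T \<longleftrightarrow> e \<in> T"
      using \<phi> by (auto simp: L_def)
    have im: "\<phi> ` S = B - S" and inj: "inj_on \<phi> S" using bij by (auto simp: bij_betw_def)
    have out: "\<phi> e \<in> B" "\<phi> e \<notin> S" if "e \<in> S" for e using im that by auto
    have "\<tau> \<in> matchings B"
      unfolding matchings_def mem_Collect_eq
    proof (intro conjI ballI partition_onI)
      have "\<Union>\<tau> = S \<union> \<phi> ` S" by (auto simp: \<tau> \<Psi>_def)
      then show "\<Union>\<tau> = B" using im assms(2) by auto
    next
      fix P Q assume "P \<in> \<tau>" "Q \<in> \<tau>" "P \<noteq> Q"
      then obtain d e where de: "d \<in> S" "e \<in> S" "P = {d, \<phi> d}" "Q = {e, \<phi> e}" "d \<noteq> e"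
        by (auto simp: \<tau> \<Psi>_def)
      then have "\<phi> d \<noteq> \<phi> e" using inj by (auto dest: inj_onD)
      then show "disjnt P Q" using de out[of d] out[of e] by (auto simp: disjnt_def)
    next
      show "{} \<notin> \<tau>" by (auto simp: \<tau> \<Psi>_def)
    next
      fix P assume "P \<in> \<tau>"
      then obtain e where "e \<in> S" "P = {e, \<phi> e}" by (auto simp: \<tau> \<Psi>_def)
      moreover have "e \<noteq> \<phi> e" using out(2)[OF \<open>e \<in> S\<close>] \<open>e \<in> S\<close> by metis
      ultimately show "card P = 2" by simp
    qed
    moreover have "\<exists>!e. e \<in> P \<inter> S" "\<exists>!e. e \<in> P \<inter> T" if P: "P \<in> \<tau>" for P
    proof -
      obtain e where "e \<in> S" "P = {e, \<phi> e}" using P by (auto simp: \<tau> \<Psi>_def)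
      then show "\<exists>!e. e \<in> P \<inter> S" "\<exists>!e. e \<in> P \<inter> T" using out[of e] lab[of e] by blast+
    qed
    ultimately show "\<tau> \<in> {\<tau> \<in> matchings B. S \<in> transversals B \<tau> \<and> T \<in> transversals B \<tau>}"
      using assms by (simp add: transversals_def)
  next
    fix \<tau> assume "\<tau> \<in> {\<tau> \<in> matchings B. S \<in> transversals B \<tau> \<and> T \<in> transversals B \<tau>}"
    then have \<tau>: "\<tau> \<in> matchings B" and S: "S \<in> transversals B \<tau>" and T: "T \<in> transversals B \<tau>" by auto
    have part: "partition_on B \<tau>" using \<tau> by (simp add: matchings_def)
    have "\<forall>e\<in>S. \<exists>e'. e' \<noteq> e \<and> {e, e'} \<in> \<tau>"
    proof
      fix e assume "e \<in> S"
      then obtain P where P: "P \<in> \<tau>" "e \<in> P" using assms(2) partition_on_ex_block[OF part] by (metis subsetD)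
      then have "card P = 2" using \<tau> by (simp add: matchings_def)
      then obtain a b where "P = {a, b}" "a \<noteq> b" by (auto simp: card_2_iff)
      then show "\<exists>e'. e' \<noteq> e \<and> {e, e'} \<in> \<tau>" using P by (auto simp: insert_commute)
    qed
    then obtain \<phi>0 where \<phi>0: "\<And>e. e \<in> S \<Longrightarrow> \<phi>0 e \<noteq> e \<and> {e, \<phi>0 e} \<in> \<tau>" by metis
    define \<phi> where "\<phi> = restrict \<phi>0 S"
    have \<phi>: "\<phi> e \<noteq> e" "{e, \<phi> e} \<in> \<tau>" if "e \<in> S" for e using \<phi>0[OF that] that by (auto simp: \<phi>_def)
    have outS: "\<phi> e \<notin> S" if "e \<in> S" for e
      using transversal_pair[OF S \<phi>(2)[OF that]] \<phi>(1)[OF that] that by simp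
    have inB: "\<phi> e \<in> B" if "e \<in> S" for e
      using \<phi>[OF that] partition_onD1[OF part] by blast
    have blocks: "P = {e, \<phi> e}" if "P \<in> \<tau>" "e \<in> P" "e \<in> S" for P e
      using partition_on_block_eq[OF part that(1) \<phi>(2)[OF that(3)] that(2)] by simp
    have surj: "\<exists>e\<in>S. P = {e, \<phi> e}" if P: "P \<in> \<tau>" for P
    proof -
      obtain e where "e \<in> P" "e \<in> S" using ex1_implies_ex[OF transversal_ex1[OF S P]] by auto
      then show ?thesis using blocks[OF P] by blast
    qed
    have "\<phi> \<in> L"
      unfolding L_def mem_Collect_eq
    proof (intro conjI ballI)
      show "\<phi> \<in> S \<rightarrow>\<^sub>E (B - S)" using inB outS by (auto simp: \<phi>_def)
      show "bij_betw \<phi> S (B - S)"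
        unfolding bij_betw_def
      proof (intro conjI inj_onI equalityI subsetI)
        fix d e assume de: "d \<in> S" "e \<in> S" and "\<phi> d = \<phi> e"
        then have "{d, \<phi> d} = {e, \<phi> e}"
          using partition_on_block_eq[OF part \<phi>(2)[OF de(1)] \<phi>(2)[OF de(2)], of "\<phi> d"] by simp
        then show "d = e" using \<open>\<phi> d = \<phi> e\<close> by (auto simp: doubleton_eq_iff)
      next
        fix x assume "x \<in> B - S"
        then obtain P where "P \<in> \<tau>" "x \<in> P" using partition_on_ex_block[OF part] by (metis DiffD1)
        then obtain e where "e \<in> S" "x \<in> {e, \<phi> e}" using surj by blast
        then show "x \<in> \<phi> ` S" using \<open>x \<in> B - S\<close> by auto
      qed (use inB outS in auto)
      fix e assume e: "e \<in> S"
      show "(\<phi> e \<notin> T) = (e \<in> T)"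
        using transversal_pair[OF T \<phi>(2)[OF e]] \<phi>(1)[OF e] by simp
    qed
    moreover have "\<tau> = \<Psi> \<phi>"
    proof (intro equalityI subsetI)
      fix P assume "P \<in> \<tau>"
      then show "P \<in> \<Psi> \<phi>" using surj unfolding \<Psi>_def by blast
    next
      fix P assume "P \<in> \<Psi> \<phi>"
      then obtain e where "e \<in> S" "P = {e, \<phi> e}" unfolding \<Psi>_def by (elim imageE)
      then show "P \<in> \<tau>" using \<phi>(2) by (simp only:)
    qed
    ultimately show "\<tau> \<in> \<Psi> ` L" by blast
  qed
  from bij_betw_same_card[OF this] show ?thesis unfolding cardL ..
qed

text \<open>The case \<open>j = 0\<close> is Wilson's theorem. A step from \<open>j\<close> to
  \<open>Suc j\<close> multiplies by \<open>- (j + 1)\<close> and divides by \<open>k - j\<close>,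
  and these two are congruent.\<close>

lemma fact_mult_fact_cong:
  assumes "prime (k + 1)" "j \<le> k"
  shows "[(- 1) ^ j * (fact (k - j) * fact j) = (- 1 :: int)] (mod int (k + 1))"
  using assms(2)
proof (induction j)
  case 0
  then show ?case using wilson_theorem[OF assms(1)] by simp
next
  case (Suc j)
  define w where "w j = (- 1) ^ j * (fact (k - j) * fact j :: int)" for j
  have "k - j = Suc (k - Suc j)" using Suc.prems by simp
  then have "fact (k - j) = (int k - int j) * fact (k - Suc j)"
    using Suc.prems by (simp add: of_nat_diff)
  then have "w j = (- 1) ^ j * ((int k - int j) * fact (k - Suc j) * fact j)"
    by (simp only: w_def)
  moreover have "w (Suc j) = - ((- 1) ^ j * (fact (k - Suc j) * ((int j + 1) * fact j)))"
    by (simp add: w_def algebra_simps)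
  ultimately have "(int k - int j) * w (Suc j) = - (int j + 1) * w j"
    by (simp only: mult_ac mult_minus_left mult_minus_right)
  then have "(int k - int j) * (w (Suc j) - w j) = - (int (k + 1) * w j)"
    by (simp add: algebra_simps)
  then have "int (k + 1) dvd int (k - j) * (w (Suc j) - w j)"
    using Suc.prems by (simp add: of_nat_diff)
  moreover have "coprime (int (k + 1)) (int (k - j))"
    using assms(1) Suc.prems by (simp only: coprime_int_iff, intro prime_imp_coprime) (auto dest: dvd_imp_le)
  ultimately have "[w (Suc j) = w j] (mod int (k + 1))"
    by (simp add: cong_iff_dvd_diff coprime_dvd_mult_right_iff)
  also have "[w j = - 1] (mod int (k + 1))" using Suc by (simp add: w_def)
  finally show ?case by (simp add: w_def)
qed

text \<open>Expand the squares and sum over \<tau> first: by the two preceding counts the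
  coefficient of \<open>r S * r T\<close> is congruent to -1 for all \<open>S\<close> and
  \<open>T\<close>, so the double sum factors. The orientations \<open>f \<tau>\<close> cancel
  within each product.\<close>

lemma sum_matchings_square_cong:
  fixes r :: "'e set \<Rightarrow> int"
  assumes "finite B" "card B = 2 * k" "prime (k + 1)" and f: "\<And>\<tau> P. \<tau> \<in> matchings B \<Longrightarrow> P \<in> \<tau> \<Longrightarrow> f \<tau> P \<in> P"
  shows "[(\<Sum>\<tau>\<in>matchings B. (\<Sum>S\<in>transversals B \<tau>. orient_sign (f \<tau>) \<tau> S * r S)\<^sup>2)
    = - (\<Sum>S | S \<subseteq> B \<and> card S = k. r S)\<^sup>2] (mod int (k + 1))"
proof -
  define K where "K = {S. S \<subseteq> B \<and> card S = k}"
  have finK: "finite K" using assms(1) by (simp add: K_def)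
  have "matchings B \<subseteq> Pow (Pow B)" by (auto simp: matchings_def partition_on_def)
  then have finM: "finite (matchings B)" using assms(1) by (simp add: finite_subset)
  \<comment> \<open>Transversals have \<open>k\<close> elements; all inner sums can thus run over
    the common set \<open>K\<close>, with an indicator, and be exchanged with the sum over
    \<tau>.\<close>
  have sub: "transversals B \<tau> \<subseteq> K" if "\<tau> \<in> matchings B" for \<tau>
    using card_transversal[OF that assms(1)] assms(2) by (auto simp: K_def transversals_def)
  have "(\<Sum>\<tau>\<in>matchings B. (\<Sum>S\<in>transversals B \<tau>. orient_sign (f \<tau>) \<tau> S * r S)\<^sup>2)
     = (\<Sum>\<tau>\<in>matchings B. \<Sum>S\<in>K. \<Sum>T\<in>K.
         if S \<in> transversals B \<tau> \<and> T \<in> transversals B \<tau> then (- 1) ^ card (S - T) * (r S * r T) else 0)"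
  proof (rule sum.cong[OF refl])
    fix \<tau> assume \<tau>: "\<tau> \<in> matchings B"
    have "(\<Sum>S\<in>transversals B \<tau>. orient_sign (f \<tau>) \<tau> S * r S)\<^sup>2
      = (\<Sum>S\<in>transversals B \<tau>. \<Sum>T\<in>transversals B \<tau>. (- 1) ^ card (S - T) * (r S * r T))"
      unfolding power2_eq_square sum_product
    proof (intro sum.cong refl)
      fix S T assume "S \<in> transversals B \<tau>" "T \<in> transversals B \<tau>"
      from orient_sign_mult[OF \<tau> assms(1) f[OF \<tau>] this]
      show "orient_sign (f \<tau>) \<tau> S * r S * (orient_sign (f \<tau>) \<tau> T * r T) = (- 1) ^ card (S - T) * (r S * r T)"
        by (simp add: algebra_simps flip: mult.assoc)
    qed
    also have "\<dots> = (\<Sum>S\<in>K. \<Sum>T\<in>K. if S \<in> transversals B \<tau> \<and> T \<in> transversals B \<tau> then (- 1) ^ card (S - T) * (r S * r T) else 0)"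
      using sub[OF \<tau>] finK
      by (intro sum.mono_neutral_cong_left) (auto intro!: sum.mono_neutral_cong_left sum.neutral)
    finally show "(\<Sum>S\<in>transversals B \<tau>. orient_sign (f \<tau>) \<tau> S * r S)\<^sup>2 = \<dots>" .
  qed
  also have "\<dots> = (\<Sum>S\<in>K. \<Sum>T\<in>K. \<Sum>\<tau>\<in>matchings B.
         if S \<in> transversals B \<tau> \<and> T \<in> transversals B \<tau> then (- 1) ^ card (S - T) * (r S * r T) else 0)"
    by (subst sum.swap) (intro sum.cong refl sum.swap)
  also have "\<dots> = (\<Sum>S\<in>K. \<Sum>T\<in>K. ((- 1) ^ card (S - T) * (fact (card (S \<inter> T)) * fact (card (S - T)))) * (r S * r T))"
  proof (intro sum.cong refl)
    fix S T assume "S \<in> K" "T \<in> K"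
    then have "int (card {\<tau> \<in> matchings B. S \<in> transversals B \<tau> \<and> T \<in> transversals B \<tau>})
        = fact (card (S \<inter> T)) * fact (card (S - T))"
      using assms(1,2) by (subst card_matchings_common_transversals) (auto simp: K_def)
    then show "(\<Sum>\<tau>\<in>matchings B. if S \<in> transversals B \<tau> \<and> T \<in> transversals B \<tau> then (- 1) ^ card (S - T) * (r S * r T) else 0)
       = ((- 1) ^ card (S - T) * (fact (card (S \<inter> T)) * fact (card (S - T)))) * (r S * r T)"
      using finM by (simp add: sum.inter_filter[symmetric] mult_ac)
  qed
  also have "[\<dots> = (\<Sum>S\<in>K. \<Sum>T\<in>K. (- 1) * (r S * r T))] (mod int (k + 1))"
  proof (intro cong_sum cong_mult cong_refl)
    fix S T assume ST: "S \<in> K" "T \<in> K"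
    then have "finite S" using assms(1) by (auto simp: K_def intro: finite_subset)
    then have "card (S \<inter> T) = k - card (S - T)" "card (S - T) \<le> k"
      using ST card_Int_Diff[of S T] by (auto simp: K_def)
    then show "[(- 1) ^ card (S - T) * (fact (card (S \<inter> T)) * fact (card (S - T))) = - 1] (mod int (k + 1))"
      using fact_mult_fact_cong[OF assms(3)] by simp
  qed
  also have "(\<Sum>S\<in>K. \<Sum>T\<in>K. (- 1) * (r S * r T)) = - (\<Sum>S\<in>K. r S)\<^sup>2"
    by (simp add: power2_eq_square sum_product sum_negf)
  finally show ?thesis by (simp add: K_def)
qed


section \<open>Graphs\<close>

lemma orientationD:
  assumes "multigraph G" "orientation G s t"
  shows "finite (verts G)" "finite (edges G)"
    and "e \<in> edges G \<Longrightarrow> s e \<in> verts G \<and> t e \<in> verts G"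
    and "edges_at G v = {e \<in> edges G. s e = v \<or> t e = v}"
    and "loops_at G v = {e \<in> edges G. s e = v \<and> t e = v}"
  using assms by (auto simp: multigraph_def orientation_def edges_at_def loops_at_def)

lemma degree_eq_inc_degree:
  assumes "multigraph G" "orientation G s t"
  shows "Defs.degree G v = inc_degree (edges G) s t v"
proof -
  have "inc_degree (edges G) s t v = (\<Sum>e\<in>edges G. (if s e = v \<or> t e = v then 1 else 0) + (if s e = v \<and> t e = v then 1 else 0))"
    unfolding inc_degree_def sum_fun_apply by (intro sum.cong) (auto simp: unit_exp_def)
  also have "\<dots> = card (edges_at G v) + card (loops_at G v)"
    unfolding sum.distrib orientationD(4,5)[OF assms] using orientationD(2)[OF assms]
    by (simp flip: sum.inter_filter)
  finally show ?thesis by (simp add: Defs.degree_def)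
qed

lemma inc_degree_regular:
  assumes "multigraph G" "orientation G s t" "regular (2 * k) G"
  shows "inc_degree (edges G) s t = (\<lambda>w. if w \<in> verts G then 2 * k else 0)"
proof
  fix w
  show "inc_degree (edges G) s t w = (if w \<in> verts G then 2 * k else 0)"
  proof (cases "w \<in> verts G")
    case True
    then show ?thesis using assms(3) by (simp add: regular_def flip: degree_eq_inc_degree[OF assms(1,2)])
  next
    case False
    then have "edges_at G w = {}" "loops_at G w = {}"
      using orientationD(3-5)[OF assms(1,2)] by auto
    then show ?thesis using False by (simp add: Defs.degree_def flip: degree_eq_inc_degree[OF assms(1,2)])
  qed
qed

lemma card_edges_at:
  assumes "regular (2 * k) G" "v \<in> verts G" "loops_at G v = {}"
  shows "card (edges_at G v) = 2 * k"
proof -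
  have "Defs.degree G v = 2 * k" using assms(1,2) by (simp add: regular_def)
  then show ?thesis by (simp add: Defs.degree_def assms(3))
qed

section \<open>The graph obtained by resolving a vertex\<close>

lemma partner_eq:
  assumes "\<tau> \<in> matchings B" "{e, e'} \<in> \<tau>" "e \<noteq> e'"
  shows "partner \<tau> e = e'"
  unfolding partner_def
proof (rule the_equality)
  fix x assume x: "x \<noteq> e \<and> {e, x} \<in> \<tau>"
  have "partition_on B \<tau>" using assms(1) by (simp add: matchings_def)
  from partition_on_block_eq[OF this, of "{e, x}" "{e, e'}" e] show "x = e'"
    using x assms by (auto simp: doubleton_eq_iff)
qed (use assms in auto)

text \<open>The edge whose name \<open>resolve\<close> reuses and its partner are the two functions
  needed for \<open>prod_matching_diff\<close>.\<close>

lemma matching_pair: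
  assumes "\<tau> \<in> matchings B" "P \<in> \<tau>"
  shows "(SOME e. e \<in> P) \<in> P" and "{SOME e. e \<in> P, partner \<tau> (SOME e. e \<in> P)} = P"
    and "(SOME e. e \<in> P) \<noteq> partner \<tau> (SOME e. e \<in> P)"
proof -
  define f where "f = (SOME e. e \<in> P)"
  have two: "card P = 2" using assms by (simp add: matchings_def)
  then have "P \<noteq> {}" by auto
  then have f: "f \<in> P" unfolding f_def by (simp add: some_in_eq)
  then have "card (P - {f}) = 1" using two by simp
  then obtain x where x: "P - {f} = {x}" by (auto simp: card_1_singleton_iff)
  then have fx: "{f, x} = P" "f \<noteq> x" using f by auto
  then have "partner \<tau> f = x" using partner_eq[OF assms(1)] assms(2) by simp
  then show "(SOME e. e \<in> P) \<in> P" "{SOME e. e \<in> P, partner \<tau> (SOME e. e \<in> P)} = P"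
    and "(SOME e. e \<in> P) \<noteq> partner \<tau> (SOME e. e \<in> P)"
    using f fx unfolding f_def by simp_all
qed

text \<open>This allows the new edges of \<open>resolve\<close> to be indexed by the pairs.\<close>

lemma inj_on_some_matching:
  assumes "\<tau> \<in> matchings B"
  shows "inj_on (\<lambda>P. SOME e. e \<in> P) \<tau>"
proof (rule inj_onI)
  fix P Q assume PQ: "P \<in> \<tau>" "Q \<in> \<tau>" "(SOME e. e \<in> P) = (SOME e. e \<in> Q)"
  have "partition_on B \<tau>" using assms by (simp add: matchings_def)
  from partition_on_block_eq[OF this PQ(1,2) matching_pair(1)[OF assms PQ(1)]]
  show "P = Q" using matching_pair(1)[OF assms PQ(2)] PQ(3) by simp
qed

lemma transitions_eq_matchings: "transitions G v = matchings (edges_at G v)"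
  by (simp add: transitions_def matchings_def)

text \<open>The new edge named \<open>e\<close> is directed from the far end of the partner of
  \<open>e\<close> to the far end of \<open>e\<close>. Degrees persist because every far end of an
  edge at \<open>v\<close> is an end of exactly one new edge, counted with multiplicity.\<close>

lemma
  fixes G :: "('v, 'e) mgraph" and v :: 'v and \<tau> :: "'e set set" and s t :: "'e \<Rightarrow> 'v"
  defines "B \<equiv> edges_at G v"
  defines "w \<equiv> opposite s t v"
  defines "s' \<equiv> (\<lambda>e. if e \<in> B then w (partner \<tau> e) else s e)"
  defines "t' \<equiv> (\<lambda>e. if e \<in> B then w e else t e)"
  assumes G: "multigraph G" "orientation G s t" and v: "loops_at G v = {}" and \<tau>: "\<tau> \<in> matchings B"
  shows resolve_orientation: "orientation (resolve G v \<tau>) s' t'"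
    and resolve_multigraph: "multigraph (resolve G v \<tau>)"
    and resolve_regular: "regular (2 * k) G \<Longrightarrow> regular (2 * k) (resolve G v \<tau>)"
    and resolve_edge_poly: "edge_poly (edges (resolve G v \<tau>)) s' t'
      = edge_poly (edges G - B) s t * (\<Prod>P\<in>\<tau>. Var (w (SOME e. e \<in> P)) - Var (w (partner \<tau> (SOME e. e \<in> P))))"
proof -
  note o = orientationD[OF G]
  have finB: "finite B" and B: "B = {e \<in> edges G. s e = v \<or> t e = v}" using o by (simp_all add: B_def)
  have noloop: "s e \<noteq> t e" if "e \<in> B" for e using that v o(5)[of v] by (auto simp: B)
  define f where "f P = (SOME e. e \<in> P)" for P :: "'e set"
  have f: "f P \<in> P" "{f P, partner \<tau> (f P)} = P" "f P \<noteq> partner \<tau> (f P)" if "P \<in> \<tau>" for P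
    using matching_pair[OF \<tau> that] by (simp_all add: f_def)
  note fin = matching_finite[OF \<tau> finB]
  have fB: "f P \<in> B" "partner \<tau> (f P) \<in> B" if "P \<in> \<tau>" for P
    using f(2)[OF that] fin(4) that by auto
  have edges': "edges (resolve G v \<tau>) = (edges G - B) \<union> f ` \<tau>"
    by (simp add: resolve_def B_def f_def)
  have inj: "inj_on f \<tau>" unfolding f_def by (rule inj_on_some_matching[OF \<tau>])
  have other: "other_end G v e = w e" if "e \<in> B" for e
    unfolding other_end_def
  proof (rule the_equality)
    have "ends G e = Upair (s e) (t e)" using that G(2) by (simp add: B orientation_def)
    then show "ends G e = Upair v (w e)" using that by (auto simp: B w_def opposite_def)
    fix x assume "ends G e = Upair v x"
    then show "x = w e" using \<open>ends G e = Upair v (w e)\<close> by auto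
  qed
  have verts': "verts (resolve G v \<tau>) = verts G - {v}" by (simp add: resolve_def)
  have w: "w e \<in> verts G - {v}" if "e \<in> B" for e
    using that noloop[OF that] o(3)[of e] by (auto simp: B w_def opposite_def)
  have st': "s' e \<in> verts G - {v} \<and> t' e \<in> verts G - {v}" if "e \<in> edges (resolve G v \<tau>)" for e
  proof (cases "e \<in> f ` \<tau>")
    case True
    then show ?thesis using fB w by (auto simp: s'_def t'_def)
  next
    case False
    then show ?thesis using that o(3)[of e] by (auto simp: edges' B s'_def t'_def)
  qed
  have ends': "ends (resolve G v \<tau>) e = Upair (s' e) (t' e)" if "e \<in> edges (resolve G v \<tau>)" for e
  proof (cases "e \<in> f ` \<tau>")
    case True
    then show ?thesis using fB by (auto simp: resolve_def other s'_def t'_def simp flip: B_def)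
  next
    case False
    then have "e \<in> edges G" "e \<notin> B" using that by (auto simp: edges')
    then show ?thesis using G(2) by (simp add: resolve_def s'_def t'_def orientation_def flip: B_def)
  qed
  show orient: "orientation (resolve G v \<tau>) s' t'" using ends' by (simp add: orientation_def)
  have "finite (edges (resolve G v \<tau>))" using o(2) fin(1) by (simp add: edges')
  then show mg: "multigraph (resolve G v \<tau>)"
    using st' ends' o(1) by (auto simp: multigraph_def verts')
  \<comment> \<open>The reused names lie in \<open>B\<close>, so they do not collide with the edges
    that are kept.\<close>
  have E': "(edges G - B) \<inter> f ` \<tau> = {}" using fB by auto
  have st_old: "s' e = s e" "t' e = t e" if "e \<in> edges G - B" for e
    using that by (auto simp: s'_def t'_def)
  have st_new: "t' (f P) = w (f P)" "s' (f P) = w (partner \<tau> (f P))" if "P \<in> \<tau>" for P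
    using fB[OF that] by (auto simp: s'_def t'_def)
  show "edge_poly (edges (resolve G v \<tau>)) s' t'
      = edge_poly (edges G - B) s t * (\<Prod>P\<in>\<tau>. Var (w (SOME e. e \<in> P)) - Var (w (partner \<tau> (SOME e. e \<in> P))))"
    unfolding edge_poly_def edges' f_def[symmetric] using o(2) fin(1) E' inj st_old st_new
    by (simp add: prod.union_disjoint prod.reindex)
  show "regular (2 * k) (resolve G v \<tau>)" if reg: "regular (2 * k) G"
  proof -
    have "inc_degree (edges (resolve G v \<tau>)) s' t' x = 2 * k" if x: "x \<in> verts G - {v}" for x
    proof -
      have "inc_degree (edges (resolve G v \<tau>)) s' t' x
        = inc_degree (edges G - B) s t x + (\<Sum>P\<in>\<tau>. unit_exp (w (f P)) x + unit_exp (w (partner \<tau> (f P))) x)"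
        unfolding inc_degree_def edges' sum_fun_apply using o(2) fin(1) E' inj st_old st_new
        by (simp add: sum.union_disjoint sum.reindex)
      also have "(\<Sum>P\<in>\<tau>. unit_exp (w (f P)) x + unit_exp (w (partner \<tau> (f P))) x) = (\<Sum>P\<in>\<tau>. \<Sum>e\<in>P. unit_exp (w e) x)"
      proof (rule sum.cong[OF refl])
        fix P assume P: "P \<in> \<tau>"
        have "(\<Sum>e\<in>P. unit_exp (w e) x) = (\<Sum>e\<in>{f P, partner \<tau> (f P)}. unit_exp (w e) x)"
          unfolding f(2)[OF P] ..
        then show "unit_exp (w (f P)) x + unit_exp (w (partner \<tau> (f P))) x = (\<Sum>e\<in>P. unit_exp (w e) x)"
          using f(3)[OF P] by simp
      qed
      also have "\<dots> = (\<Sum>e\<in>\<Union>\<tau>. unit_exp (w e) x)"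
      proof (subst sum.Union_disjoint)
        have "disjoint \<tau>" using \<tau> by (auto simp: matchings_def dest: partition_onD2)
        then show "\<forall>A\<in>\<tau>. \<forall>C\<in>\<tau>. A \<noteq> C \<longrightarrow> A \<inter> C = {}" by (auto dest: disjointD)
      qed (use fin in auto)
      \<comment> \<open>As \<open>x\<close> differs from \<open>v\<close>, only the far ends of
        edges in \<open>B\<close> can be \<open>x\<close>.\<close>
      also have "\<dots> = inc_degree B s t x"
        unfolding inc_degree_def sum_fun_apply fin(4)
        using x noloop by (intro sum.cong) (auto simp: B w_def opposite_def unit_exp_def)
      also have "inc_degree (edges G - B) s t x + inc_degree B s t x = inc_degree (edges G) s t x"
        unfolding inc_degree_def sum_fun_apply using o(2)
        by (intro sum.subset_diff[symmetric]) (auto simp: B)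
      finally show ?thesis using inc_degree_regular[OF G reg] x by simp
    qed
    then show ?thesis by (simp add: regular_def verts' degree_eq_inc_degree[OF mg orient])
  qed
qed

section \<open>The recursion and its solution\<close>

text \<open>Both sides are expressed through the numbers \<open>r S\<close>: a transition gives a
  signed sum over its transversals, and \<open>G\<close> gives, up to sign, the sum over all
  \<open>k\<close>-subsets. Then \<open>sum_matchings_square_cong\<close> applies.\<close>

lemma root_coeff_recursion:
  fixes G :: "('v, 'e) mgraph" and v :: 'v and s t :: "'e \<Rightarrow> 'v"
  defines "w \<equiv> opposite s t v"
  defines "s' \<equiv> (\<lambda>\<tau> e. if e \<in> edges_at G v then w (partner \<tau> e) else s e)"
  defines "t' \<equiv> (\<lambda>e. if e \<in> edges_at G v then w e else t e)"
  assumes G: "multigraph G" "orientation G s t" "regular (2 * k) G" and p: "prime (k + 1)"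
    and v: "v \<in> verts G" "loops_at G v = {}" "v \<noteq> z" "v \<noteq> u"
  shows "[(\<Sum>\<tau>\<in>transitions G v. (lookup (edge_poly (edges (resolve G v \<tau>)) (s' \<tau>) t') (root_exp k (verts G - {v}) z u))\<^sup>2)
    = - (lookup (edge_poly (edges G) s t) (root_exp k (verts G) z u))\<^sup>2] (mod int (k + 1))"
proof -
  note o = orientationD[OF G(1,2)]
  define B where "B = edges_at G v"
  define F where "F = edge_poly (edges G - B) s t"
  define d where "d = root_exp k (verts G) z u"
  define r where "r S = lookup (F * (\<Prod>e\<in>S. Var (w e))) (d(v := 0))" for S
  define f where "f P = (SOME e. e \<in> P)" for P :: "'e set"
  have finB: "finite B" and B: "B = {e \<in> edges G. s e = v \<or> t e = v}" using o by (simp_all add: B_def)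
  have noloop: "s e \<noteq> t e" if "e \<in> B" for e using that v o(5)[of v] by (auto simp: B)
  have cardB: "card B = 2 * k" unfolding B_def by (rule card_edges_at[OF G(3) v(1,2)])
  have d': "root_exp k (verts G - {v}) z u = d(v := 0)" by (auto simp: d_def root_exp_def)
  have dv: "d v = k" using v by (simp add: d_def root_exp_def)
  have new: "lookup (edge_poly (edges (resolve G v \<tau>)) (s' \<tau>) t') (d(v := 0))
      = (\<Sum>S\<in>transversals B \<tau>. orient_sign f \<tau> S * r S)" if \<tau>: "\<tau> \<in> matchings B" for \<tau>
  proof -
    have "edge_poly (edges (resolve G v \<tau>)) (s' \<tau>) t'
      = F * (\<Prod>P\<in>\<tau>. Var (w (f P)) - Var (w (partner \<tau> (f P))))"
      using resolve_edge_poly[OF G(1,2) v(2), of \<tau>] \<tau> unfolding s'_def t'_def w_def B_def F_def f_def by simp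
    moreover have "(\<Prod>P\<in>\<tau>. Var (w (f P)) - Var (w (partner \<tau> (f P))))
      = (\<Sum>S\<in>transversals B \<tau>. of_int (orient_sign f \<tau> S) * (\<Prod>e\<in>S. Var (w e)))"
      unfolding f_def by (rule prod_matching_diff[OF \<tau> finB matching_pair(2,3)[OF \<tau>]])
    \<comment> \<open>As monomials of exponent 0, the signs can be pulled out of
      \<open>lookup\<close>.\<close>
    moreover have "(of_int a :: 'v mpol) = Poly_Mapping.single 0 a" for a
      by (simp flip: single_of_int)
    ultimately have *: "edge_poly (edges (resolve G v \<tau>)) (s' \<tau>) t'
      = (\<Sum>S\<in>transversals B \<tau>. Poly_Mapping.single 0 (orient_sign f \<tau> S) * (F * (\<Prod>e\<in>S. Var (w e))))"
      by (simp only: sum_distrib_left mult_ac)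
    have "lookup (Poly_Mapping.single 0 a * g) m = a * lookup g m" for a m and g :: "'v mpol"
      using lookup_single_times_plus[of 0 a g m] by simp
    then show ?thesis unfolding * lookup_sum r_def by simp
  qed
  have "(lookup (edge_poly (edges G) s t) d)\<^sup>2 = (\<Sum>S | S \<subseteq> B \<and> card S = k. r S)\<^sup>2"
  proof -
    have "(lookup (edge_poly (edges G) s t) d)\<^sup>2 = (lookup (F * (\<Prod>e\<in>B. Var v - Var (w e))) d)\<^sup>2"
      unfolding F_def w_def by (rule edge_poly_split_square[OF o(2) B noloop])
    also have "lookup (F * (\<Prod>e\<in>B. Var v - Var (w e))) d
        = (\<Sum>S | S \<subseteq> B \<and> card B = card S + d v. (- 1) ^ card S * r S)"
      unfolding r_def
    proof (rule lookup_times_prod_Var_diff[OF finB])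
      show "var_free v F" unfolding F_def by (rule var_free_edge_poly) (auto simp: B)
      show "w e \<noteq> v" if "e \<in> B" for e using that noloop[OF that] by (auto simp: B w_def opposite_def)
    qed
    \<comment> \<open>The exponent \<open>k\<close> at \<open>v\<close> leaves \<open>k\<close> of
      the \<open>2 * k\<close> edges for \<open>S\<close>, so the sign is constant and disappears in
      the square.\<close>
    also have "\<dots> = (\<Sum>S | S \<subseteq> B \<and> card S = k. (- 1) ^ k * r S)"
      by (intro sum.cong) (auto simp: cardB dv)
    also have "\<dots>\<^sup>2 = (\<Sum>S | S \<subseteq> B \<and> card S = k. r S)\<^sup>2"
      by (simp add: power_mult_distrib flip: sum_distrib_left power_mult)
    finally show ?thesis .
  qed
  moreover have "[(\<Sum>\<tau>\<in>matchings B. (\<Sum>S\<in>transversals B \<tau>. orient_sign f \<tau> S * r S)\<^sup>2)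
    = - (\<Sum>S | S \<subseteq> B \<and> card S = k. r S)\<^sup>2] (mod int (k + 1))"
    unfolding f_def by (rule sum_matchings_square_cong[OF finB cardB p matching_pair(1)])
  ultimately show ?thesis
    unfolding transitions_eq_matchings d' B_def[symmetric] d_def[symmetric] using new by simp
qed

text \<open>Deleting \<open>u\<close> uses up its \<open>2 * k\<close> edges and leaves
  \<open>k\<close> edges between \<open>z\<close> and the third vertex \<open>x\<close>. The
  exponent \<open>k\<close> at \<open>x\<close> then forces the end \<open>x\<close> at all of them,
  leaving the constant 1.\<close>

lemma root_coeff_three_vertices:
  assumes G: "multigraph G" "orientation G s t" "regular (2 * k) G"
    and V: "card (verts G) = 3" and noloop: "\<not> has_loop G"
    and zu: "z \<in> verts G" "u \<in> verts G" "z \<noteq> u"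
  shows "(lookup (edge_poly (edges G) s t) (root_exp k (verts G) z u))\<^sup>2 = 1"
proof -
  note o = orientationD[OF G(1,2)]
  have "card (verts G - {z, u}) = 1" using zu o(1) V by (simp add: card_Diff_subset)
  then obtain x where x: "verts G - {z, u} = {x}" by (auto simp: card_1_singleton_iff)
  then have Vx: "verts G = {z, u, x}" "x \<noteq> z" "x \<noteq> u" using zu by auto
  have nl: "loops_at G y = {}" if "y \<in> verts G" for y using noloop that by (auto simp: has_loop_def)
  have st: "s e \<noteq> t e" if "e \<in> edges G" for e
    using nl[of "s e"] o(3)[OF that] o(5)[of "s e"] that by auto
  define B where "B = edges_at G u"
  define E where "E = edges G - B"
  have B: "B = {e \<in> edges G. s e = u \<or> t e = u}" by (simp add: B_def o(4))
  have cardB: "card B = 2 * k" unfolding B_def using zu nl by (intro card_edges_at[OF G(3)]) auto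
  have Ex: "E = {e \<in> E. s e = x \<or> t e = x}"
  proof -
    have "s e = x \<or> t e = x" if "e \<in> E" for e
    proof -
      have "e \<in> edges G" "s e \<noteq> u" "t e \<noteq> u" using that by (auto simp: E_def B)
      then show ?thesis using o(3)[of e] st[of e] Vx by auto
    qed
    then show ?thesis by auto
  qed
  \<comment> \<open>Handshake count: there are \<open>3 * k\<close> edges, hence \<open>k\<close>
    not incident to \<open>u\<close>.\<close>
  have "2 * card (edges G) = (\<Sum>y\<in>verts G. inc_degree (edges G) s t y)"
  proof -
    have "(\<Sum>y\<in>verts G. inc_degree (edges G) s t y)
      = (\<Sum>e\<in>edges G. \<Sum>y\<in>verts G. of_bool (y = t e) + of_bool (y = s e))"
      unfolding inc_degree_def sum_fun_apply by (subst sum.swap) (simp add: unit_exp_def)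
    also have "\<dots> = (\<Sum>e\<in>edges G. 2)"
      using o(1,3) by (intro sum.cong) (auto simp: sum.distrib of_bool_def)
    finally show ?thesis by simp
  qed
  also have "\<dots> = 6 * k" using V by (simp add: inc_degree_regular[OF G])
  finally have "card (edges G) = 3 * k" by simp
  then have cardE: "card E = k"
    using o(2) cardB unfolding E_def by (subst card_Diff_subset) (auto simp: B)
  define d where "d = root_exp k (verts G) z u"
  have "d u = card B" "d x = k" using zu Vx cardB by (auto simp: d_def root_exp_def)
  have "(lookup (edge_poly (edges G) s t) d)\<^sup>2 = (lookup (edge_poly E s t) (d(u := 0)))\<^sup>2"
    unfolding E_def using st \<open>d u = _\<close> by (intro edge_poly_top_coeff_square[OF o(2) B]) (auto simp: B)
  also have "\<dots> = (lookup (edge_poly (E - E) s t) (d(u := 0, x := 0)))\<^sup>2"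
    using o(2) st Vx cardE \<open>d x = k\<close> by (intro edge_poly_top_coeff_square[OF _ Ex]) (auto simp: E_def)
  also have "d(u := 0, x := 0) = 0" using zu Vx by (auto simp: d_def root_exp_def)
  finally show ?thesis
    by (simp only: d_def edge_poly_def Diff_cancel prod.empty lookup_one_zero power_one)
qed

text \<open>Induction on the number of vertices along the recursion of \<open>martin\<close>, for
  all pairs \<open>z\<close>, \<open>u\<close> and all orientations at once, since resolving a
  vertex changes the orientation.\<close>

lemma martin_cong_root_coeff:
  assumes c: "selector c" and p: "prime (k + 1)"
    and "multigraph G" "orientation G s t" "regular (2 * k) G"
    and "card (verts G) \<ge> 3" "z \<in> verts G" "u \<in> verts G" "z \<noteq> u"
  shows "[int (martin c G) = (- 1) ^ (card (verts G) - 1) *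
      (lookup (edge_poly (edges G) s t) (root_exp k (verts G) z u))\<^sup>2] (mod int (k + 1))"
  using assms(3-)
proof (induction "card (verts G)" arbitrary: G s t z u rule: less_induct)
  case less
  note G = less.prems(1-3)
  note o = orientationD[OF G(1,2)]
  let ?V = "verts G"
  show ?case
  proof (cases "has_loop G")
    case True
    then obtain x e where "e \<in> edges G" "s e = x" "t e = x" by (auto simp: has_loop_def o(5))
    \<comment> \<open>A self-loop contributes a zero factor.\<close>
    then have "edge_poly (edges G) s t = 0"
      unfolding edge_poly_def using o(2) by (intro prod_zero bexI[of _ e]) auto
    moreover have "martin c G = 0" using True by (subst martin.simps) simp
    ultimately show ?thesis by simp
  next
    case noloop: False
    show ?thesis
    proof (cases "card ?V = 3")
      case True
      then have "martin c G = 1" using noloop by (subst martin.simps) simp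
      then show ?thesis using root_coeff_three_vertices[OF G True noloop less.prems(5-7)] True by simp
    next
      case False
      then have n: "card ?V \<ge> 4" using less.prems(4) by simp
      define v where "v = c G"
      have v: "v \<in> ?V" unfolding v_def using c less.prems(5) by (auto simp: selector_def)
      have vl: "loops_at G v = {}" using noloop v by (auto simp: has_loop_def)
      \<comment> \<open>The selected vertex may be \<open>z\<close> or \<open>u\<close>, so the
        recursion is run with two other vertices \<open>z'\<close>, \<open>u'\<close> and the result
        is carried back at the end.\<close>
      have "\<not> card (?V - {v}) \<le> Suc 0" using v n by simp
      then obtain z' u' where zu': "z' \<in> ?V - {v}" "u' \<in> ?V - {v}" "z' \<noteq> u'"
        using o(1) by (metis card_le_Suc0_iff_eq finite_Diff)
      define w where "w = opposite s t v"
      define s' where "s' \<tau> e = (if e \<in> edges_at G v then w (partner \<tau> e) else s e)" for \<tau> e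
      define t' where "t' e = (if e \<in> edges_at G v then w e else t e)" for e
      define N where "N \<tau> = lookup (edge_poly (edges (resolve G v \<tau>)) (s' \<tau>) t') (root_exp k (?V - {v}) z' u')" for \<tau>
      have "martin c G = (\<Sum>\<tau>\<in>transitions G v. martin c (resolve G v \<tau>))"
        using n noloop v unfolding v_def by (subst martin.simps) simp
      then have "int (martin c G) = (\<Sum>\<tau>\<in>transitions G v. int (martin c (resolve G v \<tau>)))" by simp
      also have "[\<dots> = (\<Sum>\<tau>\<in>transitions G v. (- 1) ^ (card ?V - 2) * (N \<tau>)\<^sup>2)] (mod int (k + 1))"
      proof (rule cong_sum)
        fix \<tau> assume "\<tau> \<in> transitions G v"
        then have \<tau>: "\<tau> \<in> matchings (edges_at G v)" by (simp add: transitions_eq_matchings)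
        have V': "verts (resolve G v \<tau>) = ?V - {v}" by (simp add: resolve_def)
        have card': "card (?V - {v}) = card ?V - 1" using v by simp
        have "orientation (resolve G v \<tau>) (s' \<tau>) t'"
          using resolve_orientation[OF G(1,2) vl \<tau>] unfolding s'_def[abs_def] t'_def[abs_def] w_def .
        then have "[int (martin c (resolve G v \<tau>)) = (- 1) ^ (card (verts (resolve G v \<tau>)) - 1) *
            (lookup (edge_poly (edges (resolve G v \<tau>)) (s' \<tau>) t') (root_exp k (verts (resolve G v \<tau>)) z' u'))\<^sup>2] (mod int (k + 1))"
          using resolve_multigraph[OF G(1,2) vl \<tau>] resolve_regular[OF G(1,2) vl \<tau> G(3)] zu' n
          by (intro less.hyps) (simp_all add: V' card')
        then show "[int (martin c (resolve G v \<tau>)) = (- 1) ^ (card ?V - 2) * (N \<tau>)\<^sup>2] (mod int (k + 1))"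
          using card' by (simp add: V' N_def numeral_2_eq_2)
      qed
      also have "(\<Sum>\<tau>\<in>transitions G v. (- 1) ^ (card ?V - 2) * (N \<tau>)\<^sup>2)
          = (- 1) ^ (card ?V - 2) * (\<Sum>\<tau>\<in>transitions G v. (N \<tau>)\<^sup>2)"
        by (simp add: sum_distrib_left)
      also have "[\<dots> = (- 1) ^ (card ?V - 2) *
          - (lookup (edge_poly (edges G) s t) (root_exp k ?V z' u'))\<^sup>2] (mod int (k + 1))"
        unfolding N_def s'_def[abs_def] t'_def[abs_def] w_def using zu'
        by (intro cong_mult cong_refl root_coeff_recursion[OF G p v vl]) auto
      \<comment> \<open>The minus sign of the recursion accounts for the vertex lost in
        resolving.\<close>
      also have "(- 1) ^ (card ?V - 2) * - (lookup (edge_poly (edges G) s t) (root_exp k ?V z' u'))\<^sup>2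
          = (- 1) ^ (card ?V - 1) * (lookup (edge_poly (edges G) s t) (root_exp k ?V z' u'))\<^sup>2"
      proof -
        have "card ?V - 1 = Suc (card ?V - 2)" using n by simp
        then show ?thesis by simp
      qed
      also have "[\<dots> = (- 1) ^ (card ?V - 1) * (lookup (edge_poly (edges G) s t) (root_exp k ?V z u))\<^sup>2] (mod int (k + 1))"
        using zu' less.prems(5-7)
        by (intro cong_mult cong_refl root_coeff_independent[OF o(2,1,3) inc_degree_regular[OF G] p]) auto
      finally show ?thesis .
    qed
  qed
qed

section \<open>The permanent as a coefficient\<close>

text \<open>The exponent \<open>2 * k\<close> at \<open>u\<close> removes the edges at
  \<open>u\<close>. The remaining coefficient sums over choices of an end at each other edge taking
  every vertex of \<open>W\<close> exactly \<open>k\<close> times, which is the sum in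
  \<open>permanent_repeated_rows\<close>.\<close>

lemma graph_perm_square_cong:
  assumes G: "multigraph G" "orientation G s t" "regular (2 * k) G" and p: "prime (k + 1)"
    and zu: "z \<in> verts G" "u \<in> verts G" "z \<noteq> u" and u: "loops_at G u = {}"
  shows "[(graph_perm k G z u s t)\<^sup>2 = (lookup (edge_poly (edges G) s t) (root_exp k (verts G) z u))\<^sup>2] (mod int (k + 1))"
proof -
  note o = orientationD[OF G(1,2)]
  define B where "B = edges_at G u"
  define E where "E = edges G - B"
  define V where "V = verts G - {u}"
  define W where "W = verts G - {z, u}"
  have B: "B = {e \<in> edges G. s e = u \<or> t e = u}" by (simp add: B_def o(4))
  have fin: "finite E" "finite V" "finite W" using o(1,2) by (simp_all add: E_def V_def W_def)
  have stV: "s e \<in> V" "t e \<in> V" if "e \<in> E" for e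
    using that o(3)[of e] by (auto simp: E_def V_def B)
  define d where "d = root_exp k (verts G) z u"
  define H where "H = {h \<in> E \<rightarrow>\<^sub>E W. \<forall>w\<in>W. card {e \<in> E. h e = w} = k}"
  have "d u = card B"
    using card_edges_at[OF G(3) zu(2) u] zu by (simp add: B_def d_def root_exp_def)
  then have "(lookup (edge_poly (edges G) s t) d)\<^sup>2 = (lookup (edge_poly E s t) (d(u := 0)))\<^sup>2"
    unfolding E_def using u o(5)[of u] by (intro edge_poly_top_coeff_square[OF o(2) B]) (auto simp: B)
  also have "lookup (edge_poly E s t) (d(u := 0)) = (\<Sum>h\<in>H. \<Prod>e\<in>E. incidence s t (h e) e)"
  proof -
    \<comment> \<open>Each factor is written as a sum over all vertices of \<open>V\<close> with the
      column of the matrix as coefficients, so that the expansion runs over functions from edges to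
      vertices.\<close>
    have "edge_poly E s t = (\<Prod>e\<in>E. \<Sum>w\<in>V. Poly_Mapping.single (unit_exp w) (incidence s t w e))"
      unfolding edge_poly_def
    proof (rule prod.cong[OF refl])
      fix e assume e: "e \<in> E"
      have "Poly_Mapping.single (unit_exp w) (incidence s t w e)
          = (if w = t e then Var w else 0) - (if w = s e then Var w else 0)" for w
        by (auto simp: incidence_def Var_def single_uminus)
      then show "Var (t e) - Var (s e) = (\<Sum>w\<in>V. Poly_Mapping.single (unit_exp w) (incidence s t w e))"
        using stV[OF e] fin by (simp add: sum_subtractf)
    qed
    also have "\<dots> = (\<Sum>h\<in>E \<rightarrow>\<^sub>E V. Poly_Mapping.single (\<Sum>e\<in>E. unit_exp (h e)) (\<Prod>e\<in>E. incidence s t (h e) e))"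
      using fin by (subst prod_sum_PiE) (simp_all add: single_prod)
    finally have "lookup (edge_poly E s t) (d(u := 0))
      = (\<Sum>h\<in>E \<rightarrow>\<^sub>E V. if (\<Sum>e\<in>E. unit_exp (h e)) = d(u := 0) then \<Prod>e\<in>E. incidence s t (h e) e else 0)"
      by (simp add: lookup_sum lookup_single when_def)
    also have "\<dots> = (\<Sum>h\<in>{h \<in> E \<rightarrow>\<^sub>E V. (\<Sum>e\<in>E. unit_exp (h e)) = d(u := 0)}. \<Prod>e\<in>E. incidence s t (h e) e)"
      using fin by (intro sum.inter_filter[symmetric] finite_PiE) auto
    \<comment> \<open>The exponent 0 at \<open>z\<close> keeps \<open>h\<close> inside
      \<open>W\<close>.\<close>
    also have "{h \<in> E \<rightarrow>\<^sub>E V. (\<Sum>e\<in>E. unit_exp (h e)) = d(u := 0)} = H"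
    proof -
      have count: "(\<Sum>e\<in>E. unit_exp (h e)) w = card {e \<in> E. h e = w}" for h w
        using fin(1) by (simp add: sum_fun_apply unit_exp_def Int_def eq_commute)
      have d: "(d(u := 0)) w = (if w \<in> W then k else 0)" for w
        by (auto simp: d_def root_exp_def W_def)
      show ?thesis
      proof (intro equalityI subsetI)
        fix h assume h: "h \<in> {h \<in> E \<rightarrow>\<^sub>E V. (\<Sum>e\<in>E. unit_exp (h e)) = d(u := 0)}"
        then have *: "card {e \<in> E. h e = w} = (if w \<in> W then k else 0)" for w
          unfolding count[symmetric] d[symmetric] by simp
        have "h e \<in> W" if "e \<in> E" for e
        proof (rule ccontr)
          assume "h e \<notin> W"
          then have "{e' \<in> E. h e' = h e} = {}" using *[of "h e"] fin(1) by simp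
          then show False using that by auto
        qed
        then show "h \<in> H" using h * by (auto simp: H_def PiE_def)
      next
        fix h assume h: "h \<in> H"
        have "(\<Sum>e\<in>E. unit_exp (h e)) w = (d(u := 0)) w" for w
        proof (cases "w \<in> W")
          case True
          then show ?thesis using h by (simp only: count d H_def) simp
        next
          case False
          then have "{e \<in> E. h e = w} = {}" using h by (auto simp: H_def)
          then have "card {e \<in> E. h e = w} = 0" by (simp only: card.empty)
          then show ?thesis unfolding count d using False by simp
        qed
        then show "h \<in> {h \<in> E \<rightarrow>\<^sub>E V. (\<Sum>e\<in>E. unit_exp (h e)) = d(u := 0)}"
          using h by (auto simp: H_def W_def V_def PiE_iff)
      qed
    qed
    finally show ?thesis .
  qed
  finally have coeff: "(lookup (edge_poly (edges G) s t) d)\<^sup>2 = (\<Sum>h\<in>H. \<Prod>e\<in>E. incidence s t (h e) e)\<^sup>2" .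
  have "graph_perm k G z u s t = fact k ^ card W * (\<Sum>h\<in>H. \<Prod>e\<in>E. incidence s t (h e) e)"
    unfolding graph_perm_def H_def W_def[symmetric] B_def[symmetric] E_def[symmetric]
    by (rule permanent_repeated_rows[OF fin(1,3)])
  then have "(graph_perm k G z u s t)\<^sup>2 = (fact k ^ 2) ^ card W * (lookup (edge_poly (edges G) s t) d)\<^sup>2"
    by (simp add: coeff power_mult_distrib power_mult[symmetric] mult.commute)
  \<comment> \<open>By Wilson's theorem \<open>fact k\<close> is congruent to -1, so its square
    disappears.\<close>
  also have "[\<dots> = ((- 1) ^ 2) ^ card W * (lookup (edge_poly (edges G) s t) d)\<^sup>2] (mod int (k + 1))"
    using wilson_theorem[OF p] by (intro cong_mult cong_pow cong_refl) simp
  finally show ?thesis by (simp add: d_def)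
qed

theorem theorem4p1:
  fixes G :: "('v, 'e) mgraph" and k n p :: nat
    and z u :: 'v and src tgt :: "'e \<Rightarrow> 'v"
    and c :: "('v, 'e) mgraph \<Rightarrow> 'v"
  assumes "multigraph G" and "regular (2 * k) G"
    and "n = card (verts G)" and "n \<ge> 3"
    and "p = k + 1" and "p \<ge> 3" and "prime p"
    and "z \<in> verts G" and "u \<in> verts G" and "z \<noteq> u" and "loops_at G u = {}"
    and "orientation G src tgt"
    and "selector c"
  shows "[int (martin c G) = (- 1) ^ (n - 1) * (graph_perm k G z u src tgt)\<^sup>2] (mod int p)"
proof -
  have p: "prime (k + 1)" using assms by simp
  have "[int (martin c G) = (- 1) ^ (n - 1) *
      (lookup (edge_poly (edges G) src tgt) (root_exp k (verts G) z u))\<^sup>2] (mod int p)"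
    using martin_cong_root_coeff[OF \<open>selector c\<close> p] assms by simp
  also have "[(- 1) ^ (n - 1) * (lookup (edge_poly (edges G) src tgt) (root_exp k (verts G) z u))\<^sup>2
      = (- 1) ^ (n - 1) * (graph_perm k G z u src tgt)\<^sup>2] (mod int p)"
    unfolding \<open>p = k + 1\<close> using assms
    by (intro cong_mult cong_refl cong_sym[OF graph_perm_square_cong] p)
  finally show ?thesis .
qed

end
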